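(* Let $\mathbf{W}:[0,1]^2\to[0,1]$ be a graphon and let $S\subsetneq[0,1]$ be a measurable proper subset such that its neighborhood $\mathcal{N}(S)=\{v\in[0,1]\setminus S:\int_S\mathbf{W}(u,v)\,du>0\}$ has positive Lebesgue measure. Let $\Gamma(S)$ be the doubled graphon on the domain $D$ constructed from $\mathbf{W}$ and $S$ (see context), and let $\lambda_1$ denote the smallest nonzero eigenvalue of the normalized Laplacian operator of $\Gamma(S)$ on $L^2(D)$. Then for every $X\in L^2([0,1])$ supported only on $S$, $$\|X\|_{L^2}\le\frac{1}{\lambda_1}\,\|\overline{\mathcal{L}}X\|_{L^2},$$ where $\overline{\mathcal{L}}$ is the normalized Laplacian of $\mathbf{W}$ on $L^2([0,1])$.
   Context: A graphon is a symmetric, bounded, measurable function $\mathbf{W}:\Omega\times\Omega\to[0,1]$ on a measure space $\Omega$ (by default $\Omega=[0,1]$ with Lebesgue measure). Its degree function is $\mathbf{d}(v)=\int_\Omega\mathbf{W}(u,v)\,du$. The normalized graphon is $\overline{\mathbf{W}}(u,v)=\mathbf{W}(u,v)/\sqrt{\mathbf{d}(u)\mathbf{d}(v)}$ if $\mathbf{d}(u),\mathbf{d}(v)\ne0$ and $0$ otherwise. The normalized Laplacian is the operator on $L^2(\Omega)$ given by $\overline{\mathcal{L}}X=X-\int_\Omega\overline{\mathbf{W}}(u,\cdot)X(u)\,du$. It is taken as a standing fact that the spectrum of such a Laplacian consists of at most countably many eigenvalues in $[0,2]$ (with $1$ the only possible accumulation point and the only possible point of the essential spectrum), and that its eigenfunctions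 form an orthonormal basis of $L^2(\Omega)$. Construction of $\Gamma(S)$: let $S'$ be a set disjoint from $[0,1]$ (a copy of $S$) with a measure-preserving bijection $\theta:S'\to S$. Put $\tilde S=S\cup\mathcal{N}(S)$ and $\tilde S'=S'\cup\mathcal{N}(S)$, and extend $\theta$ to $\tilde S'\to\tilde S$ by the identity on $\mathcal{N}(S)$. Let $D=\tilde S\cup S'$, with Lebesgue measure on $\tilde S$ and the measure transported by $\theta$ on $S'$. Define $\Gamma(S):D^2\to[0,1]$ by $\Gamma(S)(u,v)=\mathbf{W}(u,v)$ if $u,v\in\tilde S$; $\Gamma(S)(u,v)=\mathbf{W}(\theta(u),\theta(v))$ if $u,v\in\tilde S'$; and $\Gamma(S)(u,v)=0$ otherwise. Its normalized Laplacian on $L^2(D)$ is defined by the formulas above with $\Omega=D$ (this operator is unchanged if the measure on $D$ is rescaled by a positive constant).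
   Formalization: Added hypothesis: no measurable A in S of positive total degree has zero W-mass between A and [0,1]\A. Otherwise the claim is false: W=1 on [0,1/2]^2 and (1/2,1]^2, 0 elsewhere, S=[0,3/4], X=1 on [0,1/2] gives zero normalized Laplacian. Any such A refutes the claim. *)

theory Defs
  imports "HOL-Analysis.Analysis"
begin

definition graphon :: "'a measure \<Rightarrow> ('a \<Rightarrow> 'a \<Rightarrow> real) \<Rightarrow> bool" where
  "graphon M W \<longleftrightarrow>
     case_prod W \<in> borel_measurable (M \<Otimes>\<^sub>M M) \<and>
     (\<forall>u\<in>space M. \<forall>v\<in>space M. 0 \<le> W u v \<and> W u v \<le> 1 \<and> W u v = W v u)"

definition graphon_degree :: "'a measure \<Rightarrow> ('a \<Rightarrow> 'a \<Rightarrow> real) \<Rightarrow> 'a \<Rightarrow> real" where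
  "graphon_degree M W v = (\<integral>u. W u v \<partial>M)"

definition normalized_graphon :: "'a measure \<Rightarrow> ('a \<Rightarrow> 'a \<Rightarrow> real) \<Rightarrow> 'a \<Rightarrow> 'a \<Rightarrow> real" where
  "normalized_graphon M W u v =
     (if graphon_degree M W u \<noteq> 0 \<and> graphon_degree M W v \<noteq> 0
      then W u v / sqrt (graphon_degree M W u * graphon_degree M W v) else 0)"

definition normalized_laplacian ::
    "'a measure \<Rightarrow> ('a \<Rightarrow> 'a \<Rightarrow> real) \<Rightarrow> ('a \<Rightarrow> real) \<Rightarrow> 'a \<Rightarrow> real" where
  "normalized_laplacian M W X v = X v - (\<integral>u. normalized_graphon M W u v * X u \<partial>M)"

text \<open>Elements of the real Hilbert space \<open>L\<^sup>2(M)\<close> are represented by functions; equality in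
  \<open>L\<^sup>2(M)\<close> is equality almost everywhere.\<close>

definition in_L2 :: "'a measure \<Rightarrow> ('a \<Rightarrow> real) \<Rightarrow> bool" where
  "in_L2 M f \<longleftrightarrow> f \<in> borel_measurable M \<and> integrable M (\<lambda>x. (f x)\<^sup>2)"

definition L2_inner :: "'a measure \<Rightarrow> ('a \<Rightarrow> real) \<Rightarrow> ('a \<Rightarrow> real) \<Rightarrow> real" where
  "L2_inner M f g = (\<integral>x. f x * g x \<partial>M)"

definition L2_norm :: "'a measure \<Rightarrow> ('a \<Rightarrow> real) \<Rightarrow> real" where
  "L2_norm M f = sqrt (\<integral>x. (f x)\<^sup>2 \<partial>M)"

definition eigenfunction ::
    "'a measure \<Rightarrow> (('a \<Rightarrow> real) \<Rightarrow> 'a \<Rightarrow> real) \<Rightarrow> real \<Rightarrow> ('a \<Rightarrow> real) \<Rightarrow> bool" where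
  "eigenfunction M T \<mu> f \<longleftrightarrow>
     in_L2 M f \<and> \<not> (AE x in M. f x = 0) \<and> (AE x in M. T f x = \<mu> * f x)"

definition eigenvalue :: "'a measure \<Rightarrow> (('a \<Rightarrow> real) \<Rightarrow> 'a \<Rightarrow> real) \<Rightarrow> real \<Rightarrow> bool" where
  "eigenvalue M T \<mu> \<longleftrightarrow> (\<exists>f. eigenfunction M T \<mu> f)"

definition smallest_nonzero_eigenvalue ::
    "'a measure \<Rightarrow> (('a \<Rightarrow> real) \<Rightarrow> 'a \<Rightarrow> real) \<Rightarrow> real \<Rightarrow> bool" where
  "smallest_nonzero_eigenvalue M T \<mu> \<longleftrightarrow>
     eigenvalue M T \<mu> \<and> \<mu> \<noteq> 0 \<and> (\<forall>\<nu>. eigenvalue M T \<nu> \<and> \<nu> \<noteq> 0 \<longrightarrow> \<mu> \<le> \<nu>)"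

text \<open>Indexing an orthonormal basis by the natural numbers loses nothing when \<open>L\<^sup>2(M)\<close> is
  separable and infinite-dimensional, as it is for Lebesgue measure on a set of positive measure
  and for the domain of a doubled graphon below.\<close>

definition orthonormal_basis_L2 :: "'a measure \<Rightarrow> (nat \<Rightarrow> 'a \<Rightarrow> real) \<Rightarrow> bool" where
  "orthonormal_basis_L2 M e \<longleftrightarrow>
     (\<forall>i. in_L2 M (e i)) \<and>
     (\<forall>i j. L2_inner M (e i) (e j) = (if i = j then 1 else 0)) \<and>
     (\<forall>f. in_L2 M f \<longrightarrow>
        (\<lambda>n. L2_norm M (\<lambda>x. f x - (\<Sum>i<n. L2_inner M f (e i) * e i x))) \<longlonglongrightarrow> 0)"

definition has_eigenbasis :: "'a measure \<Rightarrow> (('a \<Rightarrow> real) \<Rightarrow> 'a \<Rightarrow> real) \<Rightarrow> bool" where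
  "has_eigenbasis M T \<longleftrightarrow>
     (\<exists>e. orthonormal_basis_L2 M e \<and> (\<forall>i. \<exists>\<mu>. eigenfunction M T \<mu> (e i)))"

definition nbhd :: "(real \<Rightarrow> real \<Rightarrow> real) \<Rightarrow> real set \<Rightarrow> real set" where
  "nbhd W S = {v \<in> {0..1} - S. (\<integral>u. W u v \<partial>lebesgue_on S) > 0}"

text \<open>The copy of \<open>S\<close> is an arbitrary set \<open>S'\<close> of reals disjoint from the unit interval, together
  with a bijection \<open>\<theta>\<close> from \<open>S'\<close> to \<open>S\<close>. The measure on \<open>S'\<close> is the one transported by \<open>\<theta>\<close>, not
  the Lebesgue measure of \<open>S'\<close> as a set of reals, so \<open>\<theta>\<close> preserves measure by construction.\<close>

definition doubled_domain :: "(real \<Rightarrow> real \<Rightarrow> real) \<Rightarrow> real set \<Rightarrow> real set \<Rightarrow> real set" where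
  "doubled_domain W S S' = (S \<union> nbhd W S) \<union> S'"

definition doubled_measure ::
    "(real \<Rightarrow> real \<Rightarrow> real) \<Rightarrow> real set \<Rightarrow> real set \<Rightarrow> (real \<Rightarrow> real) \<Rightarrow> real measure" where
  "doubled_measure W S S' \<theta> =
     measure_of (doubled_domain W S S')
       {A. A \<subseteq> doubled_domain W S S' \<and>
           A \<inter> (S \<union> nbhd W S) \<in> sets lebesgue \<and> \<theta> ` (A \<inter> S') \<in> sets lebesgue}
       (\<lambda>A. emeasure lebesgue (A \<inter> (S \<union> nbhd W S)) + emeasure lebesgue (\<theta> ` (A \<inter> S')))"

definition doubled_graphon ::
    "(real \<Rightarrow> real \<Rightarrow> real) \<Rightarrow> real set \<Rightarrow> real set \<Rightarrow> (real \<Rightarrow> real) \<Rightarrow> real \<Rightarrow> real \<Rightarrow> real" where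
  "doubled_graphon W S S' \<theta> u v =
     (let \<theta>' = (\<lambda>x. if x \<in> S' then \<theta> x else x) in
      if u \<in> S \<union> nbhd W S \<and> v \<in> S \<union> nbhd W S then W u v
      else if u \<in> S' \<union> nbhd W S \<and> v \<in> S' \<union> nbhd W S then W (\<theta>' u) (\<theta>' v)
      else 0)"

text \<open>Some connectivity is needed: if \<open>A \<subseteq> S\<close> has positive total degree and no edges leaving it,
  then the function equal to the square root of the degree on \<open>A\<close> and to \<open>0\<close> elsewhere is a nonzero
  function supported on \<open>S\<close> in the kernel of the normalized Laplacian. The following condition
  excludes exactly these sets. It holds for every \<open>S\<close> whose neighborhood has positive measure if
  the graphon is connected, i.e. if \<open>\<integral>\<^sub>A \<integral>\<^bsub>-A\<^esub> W > 0\<close> whenever \<open>A\<close> and its complement have positive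
  measure.\<close>

definition no_component_inside ::
    "'a measure \<Rightarrow> ('a \<Rightarrow> 'a \<Rightarrow> real) \<Rightarrow> 'a set \<Rightarrow> bool" where
  "no_component_inside M W S \<longleftrightarrow>
     (\<forall>A\<in>sets M. A \<subseteq> S \<and> (\<integral>v\<in>A. graphon_degree M W v \<partial>M) > 0 \<longrightarrow>
        (\<integral>v\<in>A. (\<integral>u\<in>space M - A. W u v \<partial>M) \<partial>M) > 0)"

text \<open>The generating family of \<^const>\<open>doubled_measure\<close> is a sigma-algebra and the set function is
  countably additive on it, so that \<open>measure_of\<close> yields the intended measure.\<close>

lemma
  assumes S: "S \<in> sets lebesgue" "nbhd W S \<in> sets lebesgue" "S \<subseteq> {0..1}"
    and S': "S' \<inter> {0..1} = {}" "bij_betw \<theta> S' S"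
  shows space_doubled_measure: "space (doubled_measure W S S' \<theta>) = doubled_domain W S S'"
    and sets_doubled_measure: "sets (doubled_measure W S S' \<theta>) =
      {A. A \<subseteq> doubled_domain W S S' \<and>
          A \<inter> (S \<union> nbhd W S) \<in> sets lebesgue \<and> \<theta> ` (A \<inter> S') \<in> sets lebesgue}"
    and emeasure_doubled_measure: "A \<in> sets (doubled_measure W S S' \<theta>) \<Longrightarrow>
      emeasure (doubled_measure W S S' \<theta>) A =
      emeasure lebesgue (A \<inter> (S \<union> nbhd W S)) + emeasure lebesgue (\<theta> ` (A \<inter> S'))"
proof -
  define D where "D = doubled_domain W S S'"
  define T where "T = S \<union> nbhd W S"
  define F where "F = {A. A \<subseteq> D \<and> A \<inter> T \<in> sets lebesgue \<and> \<theta> ` (A \<inter> S') \<in> sets lebesgue}"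
  define m where "m = (\<lambda>A. emeasure lebesgue (A \<inter> T) + emeasure lebesgue (\<theta> ` (A \<inter> S')))"
  have M: "doubled_measure W S S' \<theta> = measure_of D F m"
    unfolding doubled_measure_def D_def T_def F_def m_def ..
  have inj: "inj_on \<theta> S'" and im: "\<theta> ` S' = S"
    using S'(2) by (auto simp: bij_betw_def)
  have D: "D = T \<union> S'" by (simp add: D_def T_def doubled_domain_def)
  have T: "T \<in> sets lebesgue" using S by (auto simp: T_def)
  have sa: "sigma_algebra D F"
    unfolding sigma_algebra_iff2
  proof (intro conjI allI ballI impI)
    show "F \<subseteq> Pow D" "{} \<in> F" by (auto simp: F_def)
  next
    fix A assume A: "A \<in> F"
    have "(D - A) \<inter> T = T - A \<inter> T" by (auto simp: D)
    moreover have "\<theta> ` ((D - A) \<inter> S') = S - \<theta> ` (A \<inter> S')"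
    proof -
      have "(D - A) \<inter> S' = S' - A \<inter> S'" by (auto simp: D)
      then show ?thesis using inj_on_image_set_diff[OF inj, of S' "A \<inter> S'"] im by auto
    qed
    ultimately show "D - A \<in> F" using A T S(1) by (auto simp: F_def)
  next
    fix A :: "nat \<Rightarrow> real set" assume A: "range A \<subseteq> F"
    have mT: "A i \<inter> T \<in> sets lebesgue" and mS: "\<theta> ` (A i \<inter> S') \<in> sets lebesgue"
      and sub: "A i \<subseteq> D" for i
      using A by (auto simp: F_def)
    have 1: "(\<Union>i. A i) \<inter> T = (\<Union>i. A i \<inter> T)"
      and 2: "\<theta> ` ((\<Union>i. A i) \<inter> S') = (\<Union>i. \<theta> ` (A i \<inter> S'))"
      by blast+
    have "(\<Union>i. A i) \<inter> T \<in> sets lebesgue"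
      unfolding 1 by (rule sets.countable_UN) (use mT in blast)
    moreover have "\<theta> ` ((\<Union>i. A i) \<inter> S') \<in> sets lebesgue"
      unfolding 2 by (rule sets.countable_UN) (use mS in blast)
    moreover have "(\<Union>i. A i) \<subseteq> D" using sub by blast
    ultimately show "(\<Union>i. A i) \<in> F" unfolding F_def by blast
  qed
  have FP: "F \<subseteq> Pow D" by (auto simp: F_def)
  show "space (doubled_measure W S S' \<theta>) = doubled_domain W S S'"
    unfolding M space_measure_of[OF FP] by (rule D_def)
  have sets: "sets (doubled_measure W S S' \<theta>) = F"
    unfolding M sets_measure_of[OF FP] by (rule sigma_algebra.sigma_sets_eq[OF sa])
  then show "sets (doubled_measure W S S' \<theta>) =
      {A. A \<subseteq> doubled_domain W S S' \<and>
          A \<inter> (S \<union> nbhd W S) \<in> sets lebesgue \<and> \<theta> ` (A \<inter> S') \<in> sets lebesgue}"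
    unfolding F_def D_def T_def .
  have ca: "countably_additive F m"
  proof (rule countably_additiveI)
    fix A :: "nat \<Rightarrow> real set"
    assume A: "range A \<subseteq> F" and dis: "disjoint_family A"
    have mT: "\<And>i. A i \<inter> T \<in> sets lebesgue" and mS: "\<And>i. \<theta> ` (A i \<inter> S') \<in> sets lebesgue"
      using A by (auto simp: F_def)
    have 1: "(\<Sum>i. emeasure lebesgue (A i \<inter> T)) = emeasure lebesgue (\<Union>i. A i \<inter> T)"
    proof (intro suminf_emeasure)
      show "range (\<lambda>i. A i \<inter> T) \<subseteq> sets lebesgue" using mT by blast
      show "disjoint_family (\<lambda>i. A i \<inter> T)"
        using dis unfolding disjoint_family_on_def by blast
    qed
    have 2: "(\<Sum>i. emeasure lebesgue (\<theta> ` (A i \<inter> S'))) = emeasure lebesgue (\<Union>i. \<theta> ` (A i \<inter> S'))"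
    proof (intro suminf_emeasure)
      show "range (\<lambda>i. \<theta> ` (A i \<inter> S')) \<subseteq> sets lebesgue" using mS by blast
      show "disjoint_family (\<lambda>i. \<theta> ` (A i \<inter> S'))"
        unfolding disjoint_family_on_def
      proof (intro ballI impI)
        fix i j :: nat assume "i \<noteq> j"
        then have "A i \<inter> A j = {}" using dis by (auto simp: disjoint_family_on_def)
        moreover have "\<theta> ` (A i \<inter> S') \<inter> \<theta> ` (A j \<inter> S') = \<theta> ` ((A i \<inter> S') \<inter> (A j \<inter> S'))"
          by (rule inj_on_image_Int[OF inj, symmetric]) auto
        ultimately show "\<theta> ` (A i \<inter> S') \<inter> \<theta> ` (A j \<inter> S') = {}" by auto
      qed
    qed
    have 3: "(\<Union>i. A i \<inter> T) = (\<Union>i. A i) \<inter> T"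
      and 4: "(\<Union>i. \<theta> ` (A i \<inter> S')) = \<theta> ` ((\<Union>i. A i) \<inter> S')" by blast+
    have "(\<Sum>i. m (A i)) =
        (\<Sum>i. emeasure lebesgue (A i \<inter> T)) + (\<Sum>i. emeasure lebesgue (\<theta> ` (A i \<inter> S')))"
      unfolding m_def by (rule suminf_add[symmetric]) (rule summableI)+
    also have "\<dots> = m (\<Union>i. A i)"
      unfolding 1 2 3 4 m_def ..
    finally show "(\<Sum>i. m (A i)) = m (\<Union>i. A i)" .
  qed
  show "emeasure (doubled_measure W S S' \<theta>) A =
      emeasure lebesgue (A \<inter> (S \<union> nbhd W S)) + emeasure lebesgue (\<theta> ` (A \<inter> S'))"
    if "A \<in> sets (doubled_measure W S S' \<theta>)"
  proof -
    have "emeasure (measure_of D F m) A = m A"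
    proof (rule emeasure_measure_of_sigma[OF sa _ ca])
      show "positive F m" by (simp add: positive_def m_def)
      show "A \<in> F" using that unfolding sets .
    qed
    then show ?thesis unfolding M m_def T_def .
  qed
qed

end

theory Submission
  imports Defs
begin

text \<open>Extend \<open>X\<close> to \<open>D\<close> as an odd function \<open>X'\<close>: \<open>X\<close> on \<open>S\<close>, \<open>- X \<circ> \<theta>\<close> on the copy \<open>S'\<close>, and \<open>0\<close> on
  the neighborhood. Almost every vertex of \<open>S\<close> has the same degree in \<open>\<Gamma>(S)\<close> as in \<open>W\<close>, and on the
  neighborhood the contributions of the two copies cancel. Hence the odd part of an eigenfunction
  of \<open>\<Gamma>(S)\<close>, restricted to \<open>S\<close>, satisfies the eigenvalue equation of \<open>W\<close> on \<open>S\<close>. By self-adjointness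
  of the Laplacian of \<open>W\<close>, the coefficient of \<open>X'\<close> at an eigenfunction with eigenvalue \<open>\<mu>\<close>, multiplied
  by \<open>\<mu>\<close>, is the coefficient of the odd extension of the Laplacian of \<open>X\<close>. If \<open>\<mu> = 0\<close>, the odd part
  has zero Dirichlet energy, so it vanishes because no component lies inside \<open>S\<close>. The claim
  follows from Parseval's identity on \<open>D\<close>: odd extension doubles the square of the norm of \<open>X\<close> and
  at most doubles that of its Laplacian.\<close>

subsection \<open>Square-integrable functions\<close>

lemma abs_mult_le_sum_squares: "\<bar>a\<bar> * \<bar>b\<bar> \<le> a\<^sup>2 + b\<^sup>2" for a b :: real
  using sum_squares_bound[of "\<bar>a\<bar>" "\<bar>b\<bar>"] mult_nonneg_nonneg[OF abs_ge_zero abs_ge_zero, of a b] unfolding power2_abs mult.assoc by linarith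

lemma in_L2_mult_integrable:
  assumes "in_L2 M f" "in_L2 M g"
  shows "integrable M (\<lambda>x. f x * g x)"
proof (rule Bochner_Integration.integrable_bound)
  show "integrable M (\<lambda>x. (f x)\<^sup>2 + (g x)\<^sup>2)"
    using assms by (auto simp: in_L2_def)
  show "(\<lambda>x. f x * g x) \<in> borel_measurable M"
    using assms by (auto simp: in_L2_def)
  show "AE x in M. norm (f x * g x) \<le> norm ((f x)\<^sup>2 + (g x)\<^sup>2)"
    by (simp add: abs_mult abs_mult_le_sum_squares)
qed

lemma in_L2_add:
  assumes "in_L2 M f" "in_L2 M g"
  shows "in_L2 M (\<lambda>x. f x + g x)"
  using assms in_L2_mult_integrable[OF assms]
  by (auto simp: in_L2_def power2_sum mult.assoc)

lemma in_L2_cmult: "in_L2 M f \<Longrightarrow> in_L2 M (\<lambda>x. c * f x)"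
  by (auto simp: in_L2_def power_mult_distrib)

lemma in_L2_diff:
  assumes "in_L2 M f" "in_L2 M g"
  shows "in_L2 M (\<lambda>x. f x - g x)"
  using in_L2_add[OF assms(1) in_L2_cmult[OF assms(2), of "-1"]] by simp

lemma in_L2_sum: "(\<And>i. i \<in> I \<Longrightarrow> in_L2 M (f i)) \<Longrightarrow> in_L2 M (\<lambda>x. \<Sum>i\<in>I. f i x)"
proof (induction I rule: infinite_finite_induct)
  case (insert i I)
  then show ?case using in_L2_add[of M "f i" "\<lambda>x. \<Sum>i\<in>I. f i x"] by simp
qed (auto simp: in_L2_def)

lemma in_L2_indicator_mult:
  assumes "in_L2 M f" "A \<in> sets M"
  shows "in_L2 M (\<lambda>x. indicator A x * f x)"
proof -
  have "(indicator A x * f x)\<^sup>2 = (f x)\<^sup>2 * indicator A x" for x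
    by (auto simp: indicator_def)
  then show ?thesis
    using assms by (auto simp: in_L2_def intro!: integrable_real_mult_indicator)
qed

lemma in_L2_const: "finite_measure M \<Longrightarrow> in_L2 M (\<lambda>x. c)"
  by (auto simp: in_L2_def intro!: finite_measure.integrable_const)

text \<open>Orthonormality makes the squared norm of the remainder \<open>f - s n\<close> equal to
  the squared norm of \<open>f\<close> minus the partial sum of the squared coefficients;
  completeness of the basis sends the remainder to zero.\<close>

lemma parseval:
  assumes e: "orthonormal_basis_L2 M e" and f: "in_L2 M f"
  shows "(\<lambda>i. (L2_inner M f (e i))\<^sup>2) sums (L2_norm M f)\<^sup>2"
proof -
  define a where "a i = L2_inner M f (e i)" for i
  define s where "s n x = (\<Sum>i<n. a i * e i x)" for n x
  have eL2: "in_L2 M (e i)" and ort: "L2_inner M (e i) (e j) = (if i = j then 1 else 0)" for i j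
    using e by (auto simp: orthonormal_basis_L2_def)
  have sL2: "in_L2 M (s n)" for n
    unfolding s_def by (intro in_L2_sum in_L2_cmult eL2)
  have fs: "(\<integral>x. f x * s n x \<partial>M) = (\<Sum>i<n. (a i)\<^sup>2)" for n
  proof -
    have "(\<integral>x. f x * s n x \<partial>M) = (\<integral>x. (\<Sum>i<n. a i * (f x * e i x)) \<partial>M)"
      by (simp add: s_def sum_distrib_left mult_ac)
    also have "\<dots> = (\<Sum>i<n. a i * (\<integral>x. f x * e i x \<partial>M))"
      using in_L2_mult_integrable[OF f eL2] by (subst Bochner_Integration.integral_sum) auto
    finally show ?thesis by (simp add: a_def L2_inner_def power2_eq_square)
  qed
  have es: "(\<integral>x. e j x * s n x \<partial>M) = (if j < n then a j else 0)" for j n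
  proof -
    have "(\<integral>x. e j x * s n x \<partial>M) = (\<integral>x. (\<Sum>i<n. a i * (e j x * e i x)) \<partial>M)"
      by (simp add: s_def sum_distrib_left mult_ac)
    also have "\<dots> = (\<Sum>i<n. a i * L2_inner M (e j) (e i))"
      using in_L2_mult_integrable[OF eL2 eL2]
      by (subst Bochner_Integration.integral_sum) (auto simp: L2_inner_def)
    also have "\<dots> = (\<Sum>i<n. if i = j then a i else 0)"
      by (intro sum.cong) (auto simp: ort)
    finally show ?thesis by simp
  qed
  have ss: "(\<integral>x. (s n x)\<^sup>2 \<partial>M) = (\<Sum>i<n. (a i)\<^sup>2)" for n
  proof -
    have "(\<integral>x. (s n x)\<^sup>2 \<partial>M) = (\<integral>x. (\<Sum>i<n. a i * (e i x * s n x)) \<partial>M)"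
      by (simp add: s_def[of n] power2_eq_square sum_distrib_right mult_ac)
    also have "\<dots> = (\<Sum>i<n. a i * (\<integral>x. e i x * s n x \<partial>M))"
      using in_L2_mult_integrable[OF eL2 sL2] by (subst Bochner_Integration.integral_sum) auto
    finally show ?thesis by (simp add: es power2_eq_square)
  qed
  have sq: "(L2_norm M g)\<^sup>2 = (\<integral>x. (g x)\<^sup>2 \<partial>M)" for g
    by (simp add: L2_norm_def)
  have "(L2_norm M (\<lambda>x. f x - s n x))\<^sup>2 = (L2_norm M f)\<^sup>2 - (\<Sum>i<n. (a i)\<^sup>2)" for n
  proof -
    have "(\<integral>x. (f x - s n x)\<^sup>2 \<partial>M) = (\<integral>x. (f x)\<^sup>2 + (s n x)\<^sup>2 - 2 * (f x * s n x) \<partial>M)"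
      by (simp add: power2_diff mult.assoc)
    also have "\<dots> = (\<integral>x. (f x)\<^sup>2 \<partial>M) + (\<integral>x. (s n x)\<^sup>2 \<partial>M) - 2 * (\<integral>x. f x * s n x \<partial>M)"
      using f sL2[of n] in_L2_mult_integrable[OF f sL2[of n]] by (simp add: in_L2_def)
    finally show ?thesis by (simp add: sq fs ss)
  qed
  moreover have "(\<lambda>n. (L2_norm M (\<lambda>x. f x - s n x))\<^sup>2) \<longlonglongrightarrow> 0\<^sup>2"
    by (rule tendsto_power) (use e f in \<open>auto simp: orthonormal_basis_L2_def s_def a_def\<close>)
  ultimately have "(\<lambda>n. (L2_norm M f)\<^sup>2 - (\<Sum>i<n. (a i)\<^sup>2)) \<longlonglongrightarrow> 0" by simp
  from tendsto_diff[OF tendsto_const[of "(L2_norm M f)\<^sup>2"] this]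
  show ?thesis by (simp add: sums_def a_def)
qed

text \<open>Reduces an inequality between norms to one at each basis element: the squares of the
  coefficients are summed by Parseval.\<close>

lemma L2_norm_le_of_coefficients_le:
  assumes e: "orthonormal_basis_L2 M e" and f: "in_L2 M f" and g: "in_L2 M g"
    and "c \<ge> 0"
    and le: "\<And>i. c * \<bar>L2_inner M f (e i)\<bar> \<le> \<bar>L2_inner M g (e i)\<bar>"
  shows "c * L2_norm M f \<le> L2_norm M g"
proof -
  have "c\<^sup>2 * (L2_inner M f (e i))\<^sup>2 \<le> (L2_inner M g (e i))\<^sup>2" for i
    using power_mono[OF le[of i], of 2] \<open>c \<ge> 0\<close> by (simp add: power_mult_distrib)
  from sums_le[OF this sums_mult[OF parseval[OF e f]] parseval[OF e g]]
  have "(c * L2_norm M f)\<^sup>2 \<le> (L2_norm M g)\<^sup>2" by (simp add: power_mult_distrib)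
  then show ?thesis by (rule power2_le_imp_le) (simp add: L2_norm_def)
qed

subsection \<open>The normalized Laplacian of a graphon on a finite measure space\<close>

text \<open>An arbitrary finite measure space covers both the unit interval and the doubled
  domain.\<close>

locale graphon_space = finite_measure M for M :: "'a measure" +
  fixes W :: "'a \<Rightarrow> 'a \<Rightarrow> real"
  assumes graphon: "graphon M W"
begin

sublocale MM: pair_sigma_finite M M ..

abbreviation deg :: "'a \<Rightarrow> real" where
  "deg \<equiv> graphon_degree M W"

abbreviation adj :: "('a \<Rightarrow> real) \<Rightarrow> 'a \<Rightarrow> real" where
  "adj f v \<equiv> \<integral>u. normalized_graphon M W u v * f u \<partial>M"

lemma W_nonneg: "u \<in> space M \<Longrightarrow> v \<in> space M \<Longrightarrow> 0 \<le> W u v"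
  and W_le_1: "u \<in> space M \<Longrightarrow> v \<in> space M \<Longrightarrow> W u v \<le> 1"
  and W_sym: "u \<in> space M \<Longrightarrow> v \<in> space M \<Longrightarrow> W u v = W v u"
  using graphon unfolding graphon_def by blast+

lemma W_measurable [measurable]: "case_prod W \<in> borel_measurable (M \<Otimes>\<^sub>M M)"
  using graphon unfolding graphon_def by blast

lemma W_section_measurable [measurable]:
  assumes "v \<in> space M"
  shows "(\<lambda>u. W u v) \<in> borel_measurable M" "W v \<in> borel_measurable M"
proof -
  show "(\<lambda>u. W u v) \<in> borel_measurable M"
    using measurable_compose[OF measurable_Pair2'[OF assms] W_measurable] by (simp only: prod.case)
  show "W v \<in> borel_measurable M"
    using measurable_compose[OF measurable_Pair1'[OF assms] W_measurable] by (simp only: prod.case)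
qed

lemma W_section_integrable:
  assumes "v \<in> space M"
  shows "integrable M (\<lambda>u. W u v)"
  by (rule integrable_const_bound[where B = 1])
    (use assms W_nonneg W_le_1 in \<open>auto intro!: AE_I2\<close>)

lemma deg_measurable [measurable]: "deg \<in> borel_measurable M"
proof -
  have "(\<lambda>v. \<integral>u. W u v \<partial>M) \<in> borel_measurable M" by measurable
  then show ?thesis by (simp add: graphon_degree_def[abs_def])
qed

lemma deg_nonneg: "v \<in> space M \<Longrightarrow> 0 \<le> deg v"
  unfolding graphon_degree_def by (intro integral_nonneg_AE AE_I2 W_nonneg)

lemma deg_integrable: "integrable M deg"
proof (rule integrable_const_bound[where B = "measure M (space M)"])
  have "deg v \<le> measure M (space M)" if "v \<in> space M" for v
  proof -
    have "deg v \<le> (\<integral>u. 1 \<partial>M)"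
      unfolding graphon_degree_def
      by (intro integral_mono W_section_integrable that) (auto simp: W_le_1 that)
    then show ?thesis by simp
  qed
  then show "AE v in M. norm (deg v) \<le> measure M (space M)"
    using deg_nonneg by (auto intro!: AE_I2)
qed simp

text \<open>Since \<open>x / 0 = 0\<close>, dividing by the square root of the degree covers vertices of degree
  zero as well.\<close>

lemma normalized_graphon_eq: "normalized_graphon M W u v = W u v / (sqrt (deg u) * sqrt (deg v))"
  by (auto simp: normalized_graphon_def real_sqrt_mult)

lemma adj_eq: "adj f v = (\<integral>u. W u v * (f u / sqrt (deg u)) \<partial>M) / sqrt (deg v)"
  unfolding normalized_graphon_eq by (subst integral_divide_zero[symmetric]) (simp add: divide_simps mult_ac)

lemma adj_measurable:
  assumes [measurable]: "f \<in> borel_measurable M"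
  shows "adj f \<in> borel_measurable M"
  unfolding normalized_graphon_eq by measurable

section \<open>Edge integrals and the normalized adjacency operator on square-integrable
  functions\<close>

lemma deg_scaled_square_le:
  assumes "v \<in> space M"
  shows "(f v / sqrt (deg v))\<^sup>2 * deg v \<le> (f v)\<^sup>2"
  using deg_nonneg[OF assms] by (cases "deg v = 0") (auto simp: power_divide)

lemma deg_scaled_square_integrable:
  assumes "in_L2 M f"
  shows "integrable M (\<lambda>v. (f v / sqrt (deg v))\<^sup>2 * deg v)"
proof (rule Bochner_Integration.integrable_bound)
  show "integrable M (\<lambda>v. (f v)\<^sup>2)" using assms by (simp add: in_L2_def)
  show "(\<lambda>v. (f v / sqrt (deg v))\<^sup>2 * deg v) \<in> borel_measurable M"
    using assms by (auto simp: in_L2_def)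
  show "AE v in M. norm ((f v / sqrt (deg v))\<^sup>2 * deg v) \<le> norm ((f v)\<^sup>2)"
    using deg_scaled_square_le[of _ f] deg_nonneg by (auto intro!: AE_I2 simp: abs_mult)
qed

text \<open>Integrating out the endpoint on which the square does not depend turns the weight
  \<open>W\<close> into the degree, which compensates the division by the degree. Exchanging the
  endpoints gives the second claim.\<close>

lemma edge_square_integrable:
  assumes "in_L2 M f"
  shows "integrable (M \<Otimes>\<^sub>M M) (\<lambda>(u, v). W u v * (f u / sqrt (deg u))\<^sup>2)"
    and "integrable (M \<Otimes>\<^sub>M M) (\<lambda>(u, v). W u v * (f v / sqrt (deg v))\<^sup>2)"
proof -
  have [measurable]: "f \<in> borel_measurable M" using assms by (simp add: in_L2_def)
  have swap: "(\<integral>v. W u v \<partial>M) = deg u" if "u \<in> space M" for u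
    unfolding graphon_degree_def by (rule Bochner_Integration.integral_cong) (use that W_sym in auto)
  show *: "integrable (M \<Otimes>\<^sub>M M) (\<lambda>(u, v). W u v * (f u / sqrt (deg u))\<^sup>2)"
  proof (rule MM.Fubini_integrable)
    have "(\<integral>v. norm (case (u, v) of (u, v) \<Rightarrow> W u v * (f u / sqrt (deg u))\<^sup>2) \<partial>M) =
        (f u / sqrt (deg u))\<^sup>2 * deg u" if "u \<in> space M" for u
    proof -
      have "(\<integral>v. norm (case (u, v) of (u, v) \<Rightarrow> W u v * (f u / sqrt (deg u))\<^sup>2) \<partial>M) =
          (\<integral>v. (f u / sqrt (deg u))\<^sup>2 * W u v \<partial>M)"
        by (rule Bochner_Integration.integral_cong) (use that W_nonneg in \<open>auto simp: abs_mult\<close>)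
      then show ?thesis by (simp add: swap that)
    qed
    then show "integrable M (\<lambda>u. \<integral>v. norm (case (u, v) of (u, v) \<Rightarrow> W u v * (f u / sqrt (deg u))\<^sup>2) \<partial>M)"
      by (rule Bochner_Integration.integrable_cong[THEN iffD2, OF refl _ deg_scaled_square_integrable[OF assms]])
    show "AE u in M. integrable M (\<lambda>v. case (u, v) of (u, v) \<Rightarrow> W u v * (f u / sqrt (deg u))\<^sup>2)"
    proof (rule AE_I2)
      fix u assume "u \<in> space M"
      then show "integrable M (\<lambda>v. case (u, v) of (u, v) \<Rightarrow> W u v * (f u / sqrt (deg u))\<^sup>2)"
        using W_section_integrable[of u] W_sym[of u]
        by (auto intro!: Bochner_Integration.integrable_cong[THEN iffD1, OF refl _ W_section_integrable])
    qed
  qed measurable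
  have "integrable (M \<Otimes>\<^sub>M M) (\<lambda>(u, v). W v u * (f v / sqrt (deg v))\<^sup>2)"
    using MM.integrable_product_swap[OF *] by (simp add: case_prod_beta)
  then show "integrable (M \<Otimes>\<^sub>M M) (\<lambda>(u, v). W u v * (f v / sqrt (deg v))\<^sup>2)"
    by (rule Bochner_Integration.integrable_cong[THEN iffD1, rotated 2])
      (auto simp: space_pair_measure W_sym)
qed

text \<open>The product is dominated by the sum of the two squares, each of which is integrable
  against \<open>W\<close>.\<close>

lemma edge_product_integrable:
  assumes "in_L2 M f" "in_L2 M g"
  shows "integrable (M \<Otimes>\<^sub>M M) (\<lambda>(u, v). W u v * (f u / sqrt (deg u)) * (g v / sqrt (deg v)))"
proof (rule Bochner_Integration.integrable_bound)
  have [measurable]: "f \<in> borel_measurable M" "g \<in> borel_measurable M"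
    using assms by (auto simp: in_L2_def)
  show "integrable (M \<Otimes>\<^sub>M M) (\<lambda>p. (\<lambda>(u, v). W u v * (f u / sqrt (deg u))\<^sup>2) p +
      (\<lambda>(u, v). W u v * (g v / sqrt (deg v))\<^sup>2) p)"
    by (intro Bochner_Integration.integrable_add edge_square_integrable assms)
  show "(\<lambda>(u, v). W u v * (f u / sqrt (deg u)) * (g v / sqrt (deg v))) \<in> borel_measurable (M \<Otimes>\<^sub>M M)"
    by measurable
  have *: "\<bar>w * a * b\<bar> \<le> \<bar>w * a\<^sup>2 + w * b\<^sup>2\<bar>" if "w \<ge> 0" for w a b :: real
    using mult_left_mono[OF abs_mult_le_sum_squares[of a b] that] that
    by (simp add: abs_mult algebra_simps)
  show "AE p in M \<Otimes>\<^sub>M M. norm ((\<lambda>(u, v). W u v * (f u / sqrt (deg u)) * (g v / sqrt (deg v))) p)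
      \<le> norm ((\<lambda>(u, v). W u v * (f u / sqrt (deg u))\<^sup>2) p +
      (\<lambda>(u, v). W u v * (g v / sqrt (deg v))\<^sup>2) p)"
    unfolding real_norm_def split_beta
    by (intro AE_I2) (rule *, auto simp: space_pair_measure W_nonneg)
qed

lemma AE_section_square_integrable:
  assumes "in_L2 M f"
  shows "AE v in M. integrable M (\<lambda>u. W u v * (f u / sqrt (deg u))\<^sup>2)"
  using MM.AE_integrable_snd[OF edge_square_integrable(1)[OF assms]] by simp

text \<open>Against the weight \<open>W u v\<close>, the absolute value is dominated by 1 plus the
  square, and the weight itself has finite integral.\<close>

lemma section_integrable:
  assumes f: "f \<in> borel_measurable M" and v: "v \<in> space M"
    and int: "integrable M (\<lambda>u. W u v * (f u / sqrt (deg u))\<^sup>2)"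
  shows "integrable M (\<lambda>u. W u v * (f u / sqrt (deg u)))"
proof (rule Bochner_Integration.integrable_bound)
  note [measurable] = f W_section_measurable(1)[OF v]
  show "integrable M (\<lambda>u. W u v + W u v * (f u / sqrt (deg u))\<^sup>2)"
    by (intro Bochner_Integration.integrable_add int W_section_integrable v)
  show "(\<lambda>u. W u v * (f u / sqrt (deg u))) \<in> borel_measurable M" by measurable
  have *: "\<bar>w * a\<bar> \<le> \<bar>w + w * a\<^sup>2\<bar>" if "w \<ge> 0" for w a :: real
    using mult_left_mono[OF abs_mult_le_sum_squares[of 1 a] that] that
    by (simp add: abs_mult algebra_simps)
  show "AE u in M. norm (W u v * (f u / sqrt (deg u))) \<le> norm (W u v + W u v * (f u / sqrt (deg u))\<^sup>2)"
    unfolding real_norm_def by (intro AE_I2) (rule *[OF W_nonneg[OF _ v]])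
qed

text \<open>Small degrees can make the normalized kernel unbounded, so integrability comes from
  Fubini and is claimed only for almost every vertex.\<close>

lemma AE_adj_integrable:
  assumes "in_L2 M f"
  shows "AE v in M. integrable M (\<lambda>u. normalized_graphon M W u v * f u)"
  using AE_section_square_integrable[OF assms] AE_space
proof eventually_elim
  case (elim v)
  then have "integrable M (\<lambda>u. W u v * (f u / sqrt (deg u)) / sqrt (deg v))"
    using assms by (intro integrable_divide_zero section_integrable) (auto simp: in_L2_def)
  then show ?case by (simp add: normalized_graphon_eq divide_simps mult_ac)
qed

text \<open>This is Cauchy-Schwarz for the measure with density \<open>W u v\<close> in
  \<open>u\<close>, whose total mass is the degree of \<open>v\<close>.\<close>

lemma adj_square_le:
  assumes f: "f \<in> borel_measurable M" and v: "v \<in> space M"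
    and int: "integrable M (\<lambda>u. W u v * (f u / sqrt (deg u))\<^sup>2)"
  shows "(adj f v)\<^sup>2 \<le> (\<integral>u. W u v * (f u / sqrt (deg u))\<^sup>2 \<partial>M)"
proof (cases "deg v = 0")
  case True
  then show ?thesis unfolding adj_eq
    by (simp, intro integral_nonneg_AE AE_I2) (use W_nonneg v in auto)
next
  case False
  then have pos: "deg v > 0" using deg_nonneg[OF v] by simp
  define p where "p u = f u / sqrt (deg u)" for u
  define I where "I = (\<integral>u. W u v * p u \<partial>M)"
  \<comment> \<open>\<open>c\<close> is the mean of \<open>p\<close> under this weight. It minimizes
    the quadratic expanded next, and nonnegativity at the minimum is the Cauchy-Schwarz
    inequality.\<close>
  define c where "c = I / deg v"
  have 1: "integrable M (\<lambda>u. W u v * p u)" "integrable M (\<lambda>u. W u v * (p u)\<^sup>2)"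
    using section_integrable[OF f v int] int by (auto simp: p_def)
  have "0 \<le> (\<integral>u. W u v * (p u - c)\<^sup>2 \<partial>M)"
    by (intro integral_nonneg_AE AE_I2) (use W_nonneg v in auto)
  also have "\<dots> = (\<integral>u. W u v * (p u)\<^sup>2 - 2 * c * (W u v * p u) + c\<^sup>2 * W u v \<partial>M)"
    by (simp add: power2_diff algebra_simps)
  also have "\<dots> = (\<integral>u. W u v * (p u)\<^sup>2 \<partial>M) - 2 * c * I + c\<^sup>2 * deg v"
    using 1 W_section_integrable[OF v] by (simp add: I_def graphon_degree_def)
  also have "\<dots> = (\<integral>u. W u v * (p u)\<^sup>2 \<partial>M) - I\<^sup>2 / deg v"
    using pos by (simp add: c_def power2_eq_square field_simps)
  finally show ?thesis using pos by (simp add: adj_eq I_def p_def power_divide)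
qed

text \<open>Integrating the pointwise Cauchy-Schwarz bound over \<open>v\<close> leaves an edge
  integral that is finite by Fubini.\<close>

lemma adj_in_L2:
  assumes "in_L2 M f"
  shows "in_L2 M (adj f)"
  unfolding in_L2_def
proof
  have f: "f \<in> borel_measurable M" using assms by (simp add: in_L2_def)
  show meas: "adj f \<in> borel_measurable M" by (rule adj_measurable[OF f])
  show "integrable M (\<lambda>v. (adj f v)\<^sup>2)"
  proof (rule Bochner_Integration.integrable_bound)
    show "integrable M (\<lambda>v. \<integral>u. W u v * (f u / sqrt (deg u))\<^sup>2 \<partial>M)"
      using MM.integrable_snd[OF edge_square_integrable(1)[OF assms]] by simp
    show "(\<lambda>v. (adj f v)\<^sup>2) \<in> borel_measurable M" using meas by measurable
    show "AE v in M. norm ((adj f v)\<^sup>2) \<le> norm (\<integral>u. W u v * (f u / sqrt (deg u))\<^sup>2 \<partial>M)"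
      using AE_section_square_integrable[OF assms] AE_space
    proof eventually_elim
      case (elim v)
      from adj_square_le[OF f elim(2,1)] show ?case by simp
    qed
  qed
qed

section \<open>Self-adjointness of the Laplacian\<close>

lemma inner_adj_eq:
  assumes "in_L2 M f" "in_L2 M g"
  shows "(\<integral>v. adj f v * g v \<partial>M) =
    (\<integral>(u, v). W u v * (f u / sqrt (deg u)) * (g v / sqrt (deg v)) \<partial>(M \<Otimes>\<^sub>M M))"
proof -
  have "(\<integral>v. adj f v * g v \<partial>M) =
      (\<integral>v. (\<integral>u. W u v * (f u / sqrt (deg u)) * (g v / sqrt (deg v)) \<partial>M) \<partial>M)"
    by (subst integral_mult_left_zero) (simp add: adj_eq)
  also have "\<dots> = (\<integral>(u, v). W u v * (f u / sqrt (deg u)) * (g v / sqrt (deg v)) \<partial>(M \<Otimes>\<^sub>M M))"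
    using MM.integral_snd[OF edge_product_integrable[OF assms]] by simp
  finally show ?thesis .
qed

text \<open>Written as an integral over edges, the bilinear form is unchanged when the endpoints are
  exchanged, because \<open>W\<close> is symmetric.\<close>

lemma adj_self_adjoint:
  assumes "in_L2 M f" "in_L2 M g"
  shows "(\<integral>v. adj f v * g v \<partial>M) = (\<integral>v. f v * adj g v \<partial>M)"
proof -
  have "(\<integral>v. adj g v * f v \<partial>M) =
    (\<integral>(v, u). W u v * (g u / sqrt (deg u)) * (f v / sqrt (deg v)) \<partial>(M \<Otimes>\<^sub>M M))"
    unfolding inner_adj_eq[OF assms(2,1)]
    using MM.integral_product_swap[of "\<lambda>(u, v). W u v * (g u / sqrt (deg u)) * (f v / sqrt (deg v))"]
      edge_product_integrable[OF assms(2,1)]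
    by (simp add: case_prod_beta)
  also have "\<dots> = (\<integral>(u, v). W u v * (f u / sqrt (deg u)) * (g v / sqrt (deg v)) \<partial>(M \<Otimes>\<^sub>M M))"
    by (rule Bochner_Integration.integral_cong) (auto simp: space_pair_measure W_sym mult_ac)
  also have "\<dots> = (\<integral>v. adj f v * g v \<partial>M)" by (rule inner_adj_eq[OF assms, symmetric])
  finally show ?thesis by (simp only: mult.commute)
qed

lemma laplacian_in_L2: "in_L2 M f \<Longrightarrow> in_L2 M (normalized_laplacian M W f)"
  unfolding normalized_laplacian_def[abs_def] by (intro in_L2_diff adj_in_L2)

lemma laplacian_self_adjoint:
  assumes "in_L2 M f" "in_L2 M g"
  shows "(\<integral>v. normalized_laplacian M W f v * g v \<partial>M) = (\<integral>v. f v * normalized_laplacian M W g v \<partial>M)"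
  using adj_self_adjoint[OF assms] in_L2_mult_integrable[OF assms]
    in_L2_mult_integrable[OF adj_in_L2[OF assms(1)] assms(2)]
    in_L2_mult_integrable[OF assms(1) adj_in_L2[OF assms(2)]]
  by (simp add: normalized_laplacian_def algebra_simps)

section \<open>Dirichlet energy, sign of the eigenvalues, and the kernel\<close>

lemma edge_square_integral:
  assumes "in_L2 M f"
  shows "(\<integral>(u, v). W u v * (f v / sqrt (deg v))\<^sup>2 \<partial>(M \<Otimes>\<^sub>M M)) =
      (\<integral>v. (f v / sqrt (deg v))\<^sup>2 * deg v \<partial>M)"
    and "(\<integral>(u, v). W u v * (f u / sqrt (deg u))\<^sup>2 \<partial>(M \<Otimes>\<^sub>M M)) =
      (\<integral>v. (f v / sqrt (deg v))\<^sup>2 * deg v \<partial>M)"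
proof -
  show *: "(\<integral>(u, v). W u v * (f v / sqrt (deg v))\<^sup>2 \<partial>(M \<Otimes>\<^sub>M M)) =
      (\<integral>v. (f v / sqrt (deg v))\<^sup>2 * deg v \<partial>M)"
    using MM.integral_snd[OF edge_square_integrable(2)[OF assms]]
    by (simp add: graphon_degree_def mult.commute)
  have "(\<integral>(u, v). W u v * (f u / sqrt (deg u))\<^sup>2 \<partial>(M \<Otimes>\<^sub>M M)) =
      (\<integral>(v, u). W u v * (f u / sqrt (deg u))\<^sup>2 \<partial>(M \<Otimes>\<^sub>M M))"
    using MM.integral_product_swap[of "\<lambda>(u, v). W u v * (f u / sqrt (deg u))\<^sup>2"]
      edge_square_integrable(1)[OF assms]
    by (simp add: case_prod_beta)
  also have "\<dots> = (\<integral>(u, v). W u v * (f v / sqrt (deg v))\<^sup>2 \<partial>(M \<Otimes>\<^sub>M M))"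
    by (rule Bochner_Integration.integral_cong) (auto simp: space_pair_measure W_sym)
  finally show "(\<integral>(u, v). W u v * (f u / sqrt (deg u))\<^sup>2 \<partial>(M \<Otimes>\<^sub>M M)) =
      (\<integral>v. (f v / sqrt (deg v))\<^sup>2 * deg v \<partial>M)" by (simp add: *)
qed

text \<open>Expanding the square gives two degree-weighted norms minus twice the quadratic form of
  \<open>adj\<close>. Only an inequality results because vertices of degree zero count in the norm
  of \<open>f\<close> but not in the weighted norms.\<close>

lemma edge_energy:
  assumes f: "in_L2 M f"
  shows "integrable (M \<Otimes>\<^sub>M M) (\<lambda>(u, v). W u v * (f u / sqrt (deg u) - f v / sqrt (deg v))\<^sup>2)"
    and "(\<integral>(u, v). W u v * (f u / sqrt (deg u) - f v / sqrt (deg v))\<^sup>2 \<partial>(M \<Otimes>\<^sub>M M)) \<le>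
      2 * (\<integral>v. (f v)\<^sup>2 \<partial>M) - 2 * (\<integral>v. adj f v * f v \<partial>M)"
proof -
  have eq: "(\<lambda>(u, v). W u v * (f u / sqrt (deg u) - f v / sqrt (deg v))\<^sup>2) =
      (\<lambda>p. (\<lambda>(u, v). W u v * (f u / sqrt (deg u))\<^sup>2) p + (\<lambda>(u, v). W u v * (f v / sqrt (deg v))\<^sup>2) p
        - 2 * (\<lambda>(u, v). W u v * (f u / sqrt (deg u)) * (f v / sqrt (deg v))) p)"
    by (auto simp: power2_diff algebra_simps)
  show "integrable (M \<Otimes>\<^sub>M M) (\<lambda>(u, v). W u v * (f u / sqrt (deg u) - f v / sqrt (deg v))\<^sup>2)"
    unfolding eq
    by (intro Bochner_Integration.integrable_diff Bochner_Integration.integrable_add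
        integrable_mult_right edge_square_integrable edge_product_integrable f)
  have "(\<integral>(u, v). W u v * (f u / sqrt (deg u) - f v / sqrt (deg v))\<^sup>2 \<partial>(M \<Otimes>\<^sub>M M)) =
      2 * (\<integral>v. (f v / sqrt (deg v))\<^sup>2 * deg v \<partial>M) - 2 * (\<integral>v. adj f v * f v \<partial>M)"
    unfolding eq inner_adj_eq[OF f f]
    using edge_square_integrable[OF f] edge_product_integrable[OF f f]
    by (simp add: edge_square_integral[OF f])
  moreover have "(\<integral>v. (f v / sqrt (deg v))\<^sup>2 * deg v \<partial>M) \<le> (\<integral>v. (f v)\<^sup>2 \<partial>M)"
    by (intro integral_mono deg_scaled_square_integrable f deg_scaled_square_le)
      (use f in \<open>auto simp: in_L2_def\<close>)
  ultimately show "(\<integral>(u, v). W u v * (f u / sqrt (deg u) - f v / sqrt (deg v))\<^sup>2 \<partial>(M \<Otimes>\<^sub>M M)) \<le>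
      2 * (\<integral>v. (f v)\<^sup>2 \<partial>M) - 2 * (\<integral>v. adj f v * f v \<partial>M)" by linarith
qed

text \<open>On an eigenfunction \<open>adj\<close> acts as multiplication by
  \<open>1 - \<mu>\<close>, so the energy bound says that \<open>2 * \<mu>\<close> times the squared
  norm is at least a nonnegative energy.\<close>

lemma eigenvalue_nonneg:
  assumes "eigenvalue M (normalized_laplacian M W) \<mu>"
  shows "\<mu> \<ge> 0"
proof -
  obtain f where f: "in_L2 M f" and nz: "\<not> (AE x in M. f x = 0)"
    and eig: "AE x in M. normalized_laplacian M W f x = \<mu> * f x"
    using assms by (auto simp: eigenvalue_def eigenfunction_def)
  have m [measurable]: "f \<in> borel_measurable M" "adj f \<in> borel_measurable M"
    using f adj_measurable[of f] by (auto simp: in_L2_def)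
  have "AE v in M. adj f v = (1 - \<mu>) * f v"
    using eig by eventually_elim (simp add: normalized_laplacian_def algebra_simps)
  then have "AE v in M. adj f v * f v = (1 - \<mu>) * (f v)\<^sup>2"
    by eventually_elim (simp only: power2_eq_square mult.assoc)
  then have "(\<integral>v. adj f v * f v \<partial>M) = (\<integral>v. (1 - \<mu>) * (f v)\<^sup>2 \<partial>M)"
    by (intro integral_cong_AE borel_measurable_times borel_measurable_power borel_measurable_const m)
  then have "(\<integral>v. adj f v * f v \<partial>M) = (1 - \<mu>) * (\<integral>v. (f v)\<^sup>2 \<partial>M)"
    unfolding integral_mult_right_zero .
  moreover have "0 \<le> (\<integral>(u, v). W u v * (f u / sqrt (deg u) - f v / sqrt (deg v))\<^sup>2 \<partial>(M \<Otimes>\<^sub>M M))"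
    by (intro integral_nonneg_AE AE_I2) (auto simp: space_pair_measure W_nonneg)
  ultimately have "0 \<le> \<mu> * (\<integral>v. (f v)\<^sup>2 \<partial>M)"
    using edge_energy(2)[OF f] unfolding left_diff_distrib by linarith
  moreover have "(\<integral>v. (f v)\<^sup>2 \<partial>M) > 0"
  proof -
    have "(\<integral>v. (f v)\<^sup>2 \<partial>M) \<noteq> 0"
      using nz f integral_nonneg_eq_0_iff_AE[of M "\<lambda>v. (f v)\<^sup>2"] by (simp add: in_L2_def)
    moreover have "(\<integral>v. (f v)\<^sup>2 \<partial>M) \<ge> 0" by simp
    ultimately show ?thesis by linarith
  qed
  ultimately show ?thesis by (simp add: zero_le_mult_iff)
qed

text \<open>The energy of \<open>f\<close> is zero, so \<open>f / sqrt deg\<close> takes equal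
  values at the ends of almost every edge. Its positivity set \<open>A\<close> lies in
  \<open>S\<close> and has no edges leaving it, so \<open>comp\<close> forces total degree zero on
  \<open>A\<close>; since points of \<open>A\<close> have nonzero degree, \<open>A\<close> is
  null.\<close>

lemma scaled_nonpos_of_kernel:
  assumes f: "in_L2 M f" and supp: "\<And>x. x \<in> space M \<Longrightarrow> x \<notin> S \<Longrightarrow> f x = 0"
    and ker: "AE v in M. v \<in> S \<longrightarrow> adj f v = f v"
    and comp: "no_component_inside M W S"
  shows "AE v in M. f v / sqrt (deg v) \<le> 0"
proof -
  define p where "p v = f v / sqrt (deg v)" for v
  define A where "A = {v \<in> space M. p v > 0}"
  have m [measurable]: "f \<in> borel_measurable M" "adj f \<in> borel_measurable M"
    using f adj_measurable[of f] by (auto simp: in_L2_def)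
  have A [measurable]: "A \<in> sets M" unfolding A_def p_def by measurable
  have "A \<subseteq> S" using supp by (force simp: A_def p_def)
  \<comment> \<open>The kernel equation on \<open>S\<close> suffices here, since \<open>f\<close>
    vanishes elsewhere.\<close>
  have "(\<integral>v. adj f v * f v \<partial>M) = (\<integral>v. (f v)\<^sup>2 \<partial>M)"
  proof (rule integral_cong_AE)
    show "AE v in M. adj f v * f v = (f v)\<^sup>2"
      using ker AE_space by eventually_elim (use supp in \<open>auto simp: power2_eq_square\<close>)
  qed (intro borel_measurable_times borel_measurable_power m)+
  with edge_energy(2)[OF f]
  have le: "(\<integral>(u, v). W u v * (p u - p v)\<^sup>2 \<partial>(M \<Otimes>\<^sub>M M)) \<le> 0" by (simp add: p_def)
  have nn: "AE q in M \<Otimes>\<^sub>M M. 0 \<le> (\<lambda>(u, v). W u v * (p u - p v)\<^sup>2) q"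
    by (intro AE_I2) (auto simp: space_pair_measure W_nonneg)
  have "AE q in M \<Otimes>\<^sub>M M. (\<lambda>(u, v). W u v * (p u - p v)\<^sup>2) q = 0"
    using integral_nonneg_eq_0_iff_AE[OF edge_energy(1)[OF f, folded p_def] nn]
      integral_nonneg_AE[OF nn] le by linarith
  then have AE: "AE (u, v) in M \<Otimes>\<^sub>M M. W u v = 0 \<or> p u = p v"
    by (auto elim!: eventually_mono)
  \<comment> \<open>Fubini puts the quantifier over the first endpoint outside; symmetry of
    \<open>W\<close> exchanges the roles of the endpoints.\<close>
  have "AE v in M. AE u in M. W u v = 0 \<or> p u = p v"
  proof -
    have "AE u in M. AE v in M. W u v = 0 \<or> p u = p v"
      using MM.AE_pair[OF AE] by simp
    moreover have "AE u in M. AE v in M. (W u v = 0 \<or> p u = p v) \<longrightarrow> (W v u = 0 \<or> p v = p u)"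
      by (intro AE_I2) (auto simp: W_sym)
    ultimately show ?thesis
      by eventually_elim auto
  qed
  then have "AE v in M. indicator A v *\<^sub>R (\<integral>u. indicator (space M - A) u *\<^sub>R W u v \<partial>M) = 0"
    using AE_space
  proof eventually_elim
    case (elim v)
    show ?case
    proof (cases "v \<in> A")
      case True
      have "AE u in M. indicator (space M - A) u *\<^sub>R W u v = 0"
        using elim(1) AE_space
        by eventually_elim (use True in \<open>auto simp: A_def indicator_def\<close>)
      then have "(\<integral>u. indicator (space M - A) u *\<^sub>R W u v \<partial>M) = 0"
        by (rule integral_eq_zero_AE)
      then show ?thesis by simp
    qed simp
  qed
  then have "(\<integral>v\<in>A. (\<integral>u\<in>space M - A. W u v \<partial>M) \<partial>M) = 0"
    unfolding set_lebesgue_integral_def by (rule integral_eq_zero_AE)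
  then have "\<not> (\<integral>v\<in>A. deg v \<partial>M) > 0"
    using comp A \<open>A \<subseteq> S\<close> unfolding no_component_inside_def by fastforce
  moreover have nn: "AE v in M. 0 \<le> indicator A v *\<^sub>R deg v"
    using deg_nonneg by (auto intro!: AE_I2)
  ultimately have "(\<integral>v. indicator A v *\<^sub>R deg v \<partial>M) = 0"
    using integral_nonneg_AE[OF nn] by (simp add: set_lebesgue_integral_def)
  then have "AE v in M. indicator A v *\<^sub>R deg v = 0"
    by (subst (asm) integral_nonneg_eq_0_iff_AE[OF _ nn])
      (auto intro: integrable_mult_indicator deg_integrable simp del: real_scaleR_def)
  then have "AE v in M. p v \<le> 0"
    using AE_space
  proof eventually_elim
    case (elim v)
    have "v \<notin> A"
    proof
      assume "v \<in> A"
      then have "deg v = 0" using elim(1) by simp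
      \<comment> \<open>At degree zero, division by zero gives \<open>p v = 0\<close>, contrary to
        membership in \<open>A\<close>.\<close>
      then show False using \<open>v \<in> A\<close> by (simp add: A_def p_def)
    qed
    then show ?case using elim(2) by (simp add: A_def)
  qed
  then show ?thesis by (simp add: p_def)
qed

text \<open>The one-sided result for \<open>f\<close> and \<open>- f\<close> settles all vertices of
  nonzero degree. At a vertex of \<open>S\<close> of degree zero \<open>adj f\<close> vanishes, and
  the kernel equation makes \<open>f\<close> vanish too.\<close>

lemma kernel_supported_trivial:
  assumes f: "in_L2 M f" and supp: "\<And>x. x \<in> space M \<Longrightarrow> x \<notin> S \<Longrightarrow> f x = 0"
    and ker: "AE v in M. v \<in> S \<longrightarrow> adj f v = f v"
    and comp: "no_component_inside M W S"
  shows "AE v in M. f v = 0"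
proof -
  have "in_L2 M (\<lambda>v. - f v)" using in_L2_cmult[OF f, of "-1"] by simp
  moreover have "AE v in M. v \<in> S \<longrightarrow> adj (\<lambda>u. - f u) v = - f v" using ker by simp
  ultimately have "AE v in M. - f v / sqrt (deg v) \<le> 0"
    using supp comp by (intro scaled_nonpos_of_kernel) auto
  moreover have "AE v in M. f v / sqrt (deg v) \<le> 0"
    by (rule scaled_nonpos_of_kernel[OF assms])
  ultimately show ?thesis using ker AE_space
  proof eventually_elim
    case (elim v)
    show ?case
    proof (cases "deg v = 0 \<and> v \<in> S")
      case True
      then have "adj f v = 0" by (simp add: adj_eq)
      then show ?thesis using True elim(3) by simp
    next
      case False
      then show ?thesis using elim supp by auto
    qed
  qed
qed

end

subsection \<open>The doubled graphon\<close>

locale doubling =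
  fixes W :: "real \<Rightarrow> real \<Rightarrow> real" and S S' :: "real set" and \<theta> :: "real \<Rightarrow> real"
  assumes graphon_W: "graphon (lebesgue_on {0..1}) W"
    and S_lebesgue: "S \<in> sets lebesgue" and S_subset: "S \<subseteq> {0..1}"
    and S'_disjoint: "S' \<inter> {0..1} = {}" and bij: "bij_betw \<theta> S' S"
begin

abbreviation M :: "real measure" where "M \<equiv> lebesgue_on {0..1}"
abbreviation N :: "real set" where "N \<equiv> nbhd W S"
abbreviation MD :: "real measure" where "MD \<equiv> doubled_measure W S S' \<theta>"
abbreviation \<Gamma> :: "real \<Rightarrow> real \<Rightarrow> real" where "\<Gamma> \<equiv> doubled_graphon W S S' \<theta>"

text \<open>Outside \<open>S\<close> the value is arbitrary; \<open>lift\<close> is meant to be used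
  under a restriction to \<open>S\<close>.\<close>

definition lift :: "real \<Rightarrow> real" where "lift = inv_into S' \<theta>"

text \<open>Folds the doubled domain back onto the unit interval; this is the extension of
  \<open>\<theta>\<close> that occurs inside \<open>doubled_graphon\<close>.\<close>

definition proj :: "real \<Rightarrow> real" where "proj x = (if x \<in> S' then \<theta> x else x)"

sublocale GM: graphon_space M W
  by (intro graphon_space.intro graphon_space_axioms.intro finite_measure_lebesgue_on graphon_W) simp

lemma sets_M: "A \<in> sets M \<longleftrightarrow> A \<in> sets lebesgue \<and> A \<subseteq> {0..1}"
  by (subst sets_restrict_space_iff) auto

lemma S_sets [measurable]: "S \<in> sets M"
  using S_lebesgue S_subset by (simp add: sets_M)

lemma lebesgue_on_subset: "A \<in> sets lebesgue \<Longrightarrow> A \<subseteq> {0..1} \<Longrightarrow> lebesgue_on A = restrict_space M A"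
  by (subst restrict_restrict_space) (auto simp: Int_absorb1)

text \<open>With an indicator in place of the restricted measure, the neighborhood is a superlevel
  set of a parameter integral over the unit interval, hence measurable.\<close>

lemma N_eq: "N = {v \<in> space M - S. (\<integral>u. indicator S u * W u v \<partial>M) > 0}"
  unfolding nbhd_def lebesgue_on_subset[OF S_lebesgue S_subset]
  by (subst integral_restrict_space) (use S_sets S_subset in \<open>auto simp: sets_M Int_absorb1\<close>)

lemma N_sets [measurable]: "N \<in> sets M"
proof -
  have [measurable]: "(\<lambda>v. \<integral>u. indicator S u * W u v \<partial>M) \<in> borel_measurable M"
    by measurable
  show ?thesis unfolding N_eq by measurable
qed

lemma N_subset: "N \<subseteq> {0..1} - S" by (auto simp: nbhd_def)

lemma N_lebesgue: "N \<in> sets lebesgue" using N_sets by (simp add: sets_M)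

lemma T_sets [measurable]: "S \<union> N \<in> sets M" by simp

lemma T_subset: "S \<union> N \<subseteq> {0..1}" using N_subset S_subset by auto

lemma lift_in: "s \<in> S \<Longrightarrow> lift s \<in> S'" and theta_lift: "s \<in> S \<Longrightarrow> \<theta> (lift s) = s"
  and theta_in: "x \<in> S' \<Longrightarrow> \<theta> x \<in> S" and lift_theta: "x \<in> S' \<Longrightarrow> lift (\<theta> x) = x"
  using bij unfolding lift_def
  by (auto simp: bij_betw_def inv_into_into f_inv_into_f)

lemma not_S': "x \<in> S \<Longrightarrow> x \<notin> S'" "x \<in> N \<Longrightarrow> x \<notin> S'"
  using S'_disjoint S_subset N_subset by auto

section \<open>The measure on the doubled domain\<close>

lemma space_MD: "space MD = S \<union> N \<union> S'"
  using space_doubled_measure[OF S_lebesgue N_lebesgue S_subset S'_disjoint bij]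
  by (simp add: doubled_domain_def)

lemma sets_MD: "A \<in> sets MD \<longleftrightarrow>
    A \<subseteq> S \<union> N \<union> S' \<and> A \<inter> (S \<union> N) \<in> sets lebesgue \<and> \<theta> ` (A \<inter> S') \<in> sets lebesgue"
  using sets_doubled_measure[OF S_lebesgue N_lebesgue S_subset S'_disjoint bij]
  by (simp add: doubled_domain_def)

lemmas emeasure_MD = emeasure_doubled_measure[OF S_lebesgue N_lebesgue S_subset S'_disjoint bij]

lemma sets_MD_T:
  assumes "A \<in> sets lebesgue" "A \<subseteq> S \<union> N"
  shows "A \<in> sets MD"
proof -
  have "A \<inter> S' = {}" "A \<inter> (S \<union> N) = A" using assms not_S' by auto
  then show ?thesis using assms by (auto simp: sets_MD)
qed

lemma S_sets_MD [measurable]: "S \<in> sets MD" and N_sets_MD [measurable]: "N \<in> sets MD"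
  and T_sets_MD: "S \<union> N \<in> sets MD"
  using S_lebesgue N_lebesgue by (auto intro!: sets_MD_T)

lemma S'_sets_MD [measurable]: "S' \<in> sets MD"
proof -
  have "S' \<inter> (S \<union> N) = {}" "\<theta> ` (S' \<inter> S') = S"
    using not_S' bij by (auto simp: bij_betw_def)
  then show ?thesis using S_lebesgue by (auto simp: sets_MD)
qed

sublocale D: finite_measure MD
proof (rule finite_measureI)
  have "\<theta> ` (space MD \<inter> S') = S" "space MD \<inter> (S \<union> N) = S \<union> N"
    using bij by (auto simp: bij_betw_def space_MD)
  then have "emeasure MD (space MD) = emeasure lebesgue (S \<union> N) + emeasure lebesgue S"
    using emeasure_MD[OF sets.top] by simp
  also have "\<dots> = emeasure M (S \<union> N) + emeasure M S"
    using T_subset S_subset by (simp add: emeasure_restrict_space)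
  finally show "emeasure MD (space MD) \<noteq> \<infinity>" by (simp add: GM.emeasure_eq_measure)
qed

text \<open>Subsets of \<open>S \<union> N\<close> do not meet \<open>S'\<close>, so the second
  summand of the measure vanishes on them.\<close>

lemma restrict_MD_T: "restrict_space MD (S \<union> N) = restrict_space M (S \<union> N)"
  unfolding lebesgue_on_subset[OF sets.Un[OF S_lebesgue N_lebesgue] T_subset, symmetric]
proof (rule measure_eqI)
  show "sets (restrict_space MD (S \<union> N)) = sets (lebesgue_on (S \<union> N))"
  proof (intro set_eqI)
    fix A
    have "A \<in> sets (restrict_space MD (S \<union> N)) \<longleftrightarrow> A \<subseteq> S \<union> N \<and> A \<in> sets MD"
      by (subst sets_restrict_space_iff) (use T_sets_MD space_MD in \<open>auto simp: Int_absorb2\<close>)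
    also have "\<dots> \<longleftrightarrow> A \<subseteq> S \<union> N \<and> A \<in> sets lebesgue"
      using sets_MD_T[of A] by (auto simp: sets_MD Int_absorb2)
    also have "\<dots> \<longleftrightarrow> A \<in> sets (lebesgue_on (S \<union> N))"
      by (subst sets_restrict_space_iff) (use S_lebesgue N_lebesgue in auto)
    finally show "A \<in> sets (restrict_space MD (S \<union> N)) \<longleftrightarrow> A \<in> sets (lebesgue_on (S \<union> N))" .
  qed
next
  fix A assume "A \<in> sets (restrict_space MD (S \<union> N))"
  then have A: "A \<subseteq> S \<union> N" "A \<in> sets MD"
    by (subst (asm) sets_restrict_space_iff; use T_sets_MD space_MD in \<open>auto simp: Int_absorb2\<close>)+
  then have "A \<inter> S' = {}" "A \<inter> (S \<union> N) = A" using not_S' by auto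
  then have "emeasure MD A = emeasure lebesgue A" using emeasure_MD[OF A(2)] by simp
  then show "emeasure (restrict_space MD (S \<union> N)) A = emeasure (lebesgue_on (S \<union> N)) A"
    using A T_sets_MD space_MD S_lebesgue N_lebesgue
    by (simp add: emeasure_restrict_space Int_absorb2)
qed

text \<open>The measure on the copy is given through images under \<open>\<theta>\<close>. Read as
  preimages under \<open>lift\<close>, they fit measurability and push-forward.\<close>

lemma lift_vimage:
  assumes "A \<subseteq> space MD"
  shows "lift -` A \<inter> S = \<theta> ` (A \<inter> S')"
  using lift_in theta_lift theta_in lift_theta by (force simp: image_iff)

lemma T_Int_space: "(S \<union> N) \<inter> space MD \<in> sets MD" "(S \<union> N) \<inter> space M \<in> sets M"
  "S' \<inter> space MD \<in> sets MD" "S \<inter> space M \<in> sets M"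
  by (intro sets.Int sets.top T_sets_MD S'_sets_MD T_sets S_sets)+

lemma lift_measurable: "lift \<in> restrict_space M S \<rightarrow>\<^sub>M restrict_space MD S'"
proof (rule measurable_restrict_space2)
  show "lift \<in> space (restrict_space M S) \<rightarrow> S'"
    using lift_in by (auto simp: space_restrict_space)
  show "lift \<in> restrict_space M S \<rightarrow>\<^sub>M MD"
  proof (rule measurableI)
    fix x assume "x \<in> space (restrict_space M S)"
    then show "lift x \<in> space MD" using lift_in by (auto simp: space_restrict_space space_MD)
  next
    fix A assume A: "A \<in> sets MD"
    have "lift -` A \<inter> space (restrict_space M S) = \<theta> ` (A \<inter> S')"
      using lift_vimage[OF sets.sets_into_space[OF A]] S_subset
      by (simp add: space_restrict_space Int_absorb1 Int_absorb2)
    moreover have "\<theta> ` (A \<inter> S') \<subseteq> S" using theta_in by auto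
    ultimately show "lift -` A \<inter> space (restrict_space M S) \<in> sets (restrict_space M S)"
      using A S_subset unfolding sets_restrict_space_iff[OF T_Int_space(4)]
      by (auto simp: sets_MD sets_M)
  qed
qed

text \<open>The copy is a push-forward of \<open>S\<close>. Together with
  \<open>restrict_MD_T\<close> this reduces integration over the doubled domain to the unit
  interval.\<close>

lemma restrict_MD_S': "restrict_space MD S' = distr (restrict_space M S) (restrict_space MD S') lift"
proof (rule measure_eqI)
  fix A assume "A \<in> sets (restrict_space MD S')"
  then have A: "A \<in> sets MD" "A \<subseteq> S'" and A': "A \<in> sets (restrict_space MD S')"
    using S'_sets_MD space_MD by (auto simp: sets_restrict_space_iff)
  have "A \<inter> (S \<union> N) = {}" using A not_S' by auto
  then have "emeasure MD A = emeasure lebesgue (\<theta> ` (A \<inter> S'))" using emeasure_MD[OF A(1)] by simp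
  also have "\<dots> = emeasure M (\<theta> ` (A \<inter> S'))"
    by (rule emeasure_restrict_space[symmetric]) (use theta_in S_subset in auto)
  also have "\<dots> = emeasure (restrict_space M S) (\<theta> ` (A \<inter> S'))"
    by (rule emeasure_restrict_space[symmetric]) (use theta_in S_sets S_subset in \<open>auto simp: Int_absorb2\<close>)
  also have "\<dots> = emeasure (distr (restrict_space M S) (restrict_space MD S') lift) A"
    using lift_vimage[OF sets.sets_into_space[OF A(1)]] S_subset
    by (subst emeasure_distr[OF lift_measurable A']) (simp add: space_restrict_space Int_absorb1 Int_absorb2)
  finally show "emeasure (restrict_space MD S') A =
      emeasure (distr (restrict_space M S) (restrict_space MD S') lift) A"
    using A S'_sets_MD space_MD by (simp add: emeasure_restrict_space Int_absorb2)
qed simp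

section \<open>Transfer of null sets and integrals to the unit interval\<close>

lemma AE_MD:
  assumes "AE x in MD. P x"
  shows "AE x in M. x \<in> S \<union> N \<longrightarrow> P x" and "AE x in M. x \<in> S \<longrightarrow> P (lift x)"
proof -
  have "AE x in restrict_space MD (S \<union> N). P x"
    unfolding AE_restrict_space_iff[OF T_Int_space(1)] using assms by auto
  then show "AE x in M. x \<in> S \<union> N \<longrightarrow> P x"
    unfolding restrict_MD_T AE_restrict_space_iff[OF T_Int_space(2)] .
  have "AE x in restrict_space MD S'. P x"
    unfolding AE_restrict_space_iff[OF T_Int_space(3)] using assms by auto
  then have "AE x in distr (restrict_space M S) (restrict_space MD S') lift. P x"
    unfolding restrict_MD_S'[symmetric] .
  from AE_distrD[OF lift_measurable this]
  show "AE x in M. x \<in> S \<longrightarrow> P (lift x)"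
    unfolding AE_restrict_space_iff[OF T_Int_space(4)] .
qed

lemma integrable_MD_part:
  fixes f :: "real \<Rightarrow> real"
  shows "integrable MD (\<lambda>x. indicator (S \<union> N) x * f x) \<longleftrightarrow> integrable M (\<lambda>x. indicator (S \<union> N) x * f x)"
    and "(\<integral>x. indicator (S \<union> N) x * f x \<partial>MD) = (\<integral>x. indicator (S \<union> N) x * f x \<partial>M)"
  using integrable_restrict_space[OF T_Int_space(1), of f] integrable_restrict_space[OF T_Int_space(2), of f]
    integral_restrict_space[OF T_Int_space(1), of f] integral_restrict_space[OF T_Int_space(2), of f]
  unfolding restrict_MD_T by simp_all

lemma integrable_MD_copy:
  fixes f :: "real \<Rightarrow> real"
  assumes "f \<in> borel_measurable MD"
  shows "integrable MD (\<lambda>x. indicator S' x * f x) \<longleftrightarrow> integrable M (\<lambda>x. indicator S x * f (lift x))"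
    and "(\<integral>x. indicator S' x * f x \<partial>MD) = (\<integral>x. indicator S x * f (lift x) \<partial>M)"
proof -
  have f: "f \<in> borel_measurable (restrict_space MD S')"
    by (rule measurable_restrict_space1[OF assms])
  have "integrable (restrict_space MD S') f \<longleftrightarrow> integrable (restrict_space M S) (\<lambda>x. f (lift x))"
    by (subst restrict_MD_S') (rule integrable_distr_eq[OF lift_measurable f])
  then show "integrable MD (\<lambda>x. indicator S' x * f x) \<longleftrightarrow> integrable M (\<lambda>x. indicator S x * f (lift x))"
    by (simp add: integrable_restrict_space[OF T_Int_space(3)] integrable_restrict_space[OF T_Int_space(4)])
  have "integral\<^sup>L (restrict_space MD S') f = integral\<^sup>L (restrict_space M S) (\<lambda>x. f (lift x))"
    by (subst restrict_MD_S') (rule integral_distr[OF lift_measurable f])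
  then show "(\<integral>x. indicator S' x * f x \<partial>MD) = (\<integral>x. indicator S x * f (lift x) \<partial>M)"
    by (simp add: integral_restrict_space[OF T_Int_space(3)] integral_restrict_space[OF T_Int_space(4)])
qed

lemma MD_split: "x \<in> space MD \<Longrightarrow> indicator (S \<union> N) x * f x + indicator S' x * f x = (f x :: real)"
  using not_S' by (auto simp: space_MD indicator_def)

lemma integrable_MDI:
  fixes f :: "real \<Rightarrow> real"
  assumes f: "f \<in> borel_measurable MD"
    and "integrable M (\<lambda>x. indicator (S \<union> N) x * f x)" "integrable M (\<lambda>x. indicator S x * f (lift x))"
  shows "integrable MD f"
proof -
  have *: "integrable MD (\<lambda>x. indicator (S \<union> N) x * f x + indicator S' x * f x)"
    using assms by (intro Bochner_Integration.integrable_add)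
      (simp_all only: integrable_MD_part integrable_MD_copy[OF f])
  show ?thesis
    by (rule Bochner_Integration.integrable_cong[THEN iffD1, OF refl _ *]) (rule MD_split)
qed

text \<open>\<open>S \<union> N\<close> and \<open>S'\<close> partition the doubled domain; the part
  over the copy is pulled back to \<open>S\<close> along \<open>lift\<close>.\<close>

lemma integral_MD:
  fixes f :: "real \<Rightarrow> real"
  assumes "integrable MD f"
  shows "integrable M (\<lambda>x. indicator (S \<union> N) x * f x)"
    and "integrable M (\<lambda>x. indicator S x * f (lift x))"
    and "(\<integral>x. f x \<partial>MD) = (\<integral>x. indicator (S \<union> N) x * f x \<partial>M) + (\<integral>x. indicator S x * f (lift x) \<partial>M)"
proof -
  note f = borel_measurable_integrable[OF assms]
  have 1: "integrable MD (\<lambda>x. indicator (S \<union> N) x * f x)" "integrable MD (\<lambda>x. indicator S' x * f x)"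
    using integrable_real_mult_indicator[OF T_sets_MD assms] integrable_real_mult_indicator[OF S'_sets_MD assms]
    by (simp_all add: mult.commute)
  then show "integrable M (\<lambda>x. indicator (S \<union> N) x * f x)"
    "integrable M (\<lambda>x. indicator S x * f (lift x))"
    by (simp_all only: integrable_MD_part integrable_MD_copy[OF f])
  have "(\<integral>x. f x \<partial>MD) = (\<integral>x. indicator (S \<union> N) x * f x + indicator S' x * f x \<partial>MD)"
    by (rule Bochner_Integration.integral_cong[OF refl MD_split[symmetric]])
  also have "\<dots> = (\<integral>x. indicator (S \<union> N) x * f x \<partial>MD) + (\<integral>x. indicator S' x * f x \<partial>MD)"
    by (rule Bochner_Integration.integral_add[OF 1])
  finally show "(\<integral>x. f x \<partial>MD) =
      (\<integral>x. indicator (S \<union> N) x * f x \<partial>M) + (\<integral>x. indicator S x * f (lift x) \<partial>M)"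
    unfolding integrable_MD_part integrable_MD_copy[OF f] .
qed

section \<open>The doubled graphon and its degrees\<close>

lemma proj_eq: "x \<in> S \<union> N \<Longrightarrow> proj x = x" "x \<in> S \<Longrightarrow> proj (lift x) = x"
  using not_S' lift_in theta_lift by (auto simp: proj_def)

lemma proj_measurable [measurable]: "proj \<in> MD \<rightarrow>\<^sub>M M"
proof (rule measurableI)
  show "proj x \<in> space M" if "x \<in> space MD" for x
    using that S_subset N_subset theta_in[of x] by (auto simp: space_MD proj_def)
  fix A assume "A \<in> sets M"
  then have A: "A \<in> sets lebesgue" by (simp add: sets_M)
  have "(proj -` A \<inter> space MD) \<inter> (S \<union> N) = A \<inter> (S \<union> N)"
    using proj_eq(1) by (auto simp: space_MD)
  moreover have "\<theta> ` ((proj -` A \<inter> space MD) \<inter> S') = A \<inter> S"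
    using theta_in theta_lift lift_in by (force simp: space_MD proj_def image_iff)
  ultimately show "proj -` A \<inter> space MD \<in> sets MD"
    using A S_lebesgue N_lebesgue by (auto simp: sets_MD space_MD)
qed

text \<open>\<open>proj\<close> is the identity on \<open>S \<union> N\<close>, so both nonzero
  branches of the definition take the same form. Measurability of \<open>\<Gamma>\<close> then
  follows from that of \<open>W\<close> and \<open>proj\<close>.\<close>

lemma doubled_graphon_eq:
  "\<Gamma> u v = (if u \<in> S \<union> N \<and> v \<in> S \<union> N \<or> u \<in> S' \<union> N \<and> v \<in> S' \<union> N then W (proj u) (proj v) else 0)"
  using proj_eq(1) unfolding doubled_graphon_def Let_def proj_def[symmetric] by auto

sublocale GD: graphon_space MD \<Gamma>
proof (intro graphon_space.intro D.finite_measure_axioms graphon_space_axioms.intro)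
  have [measurable]: "(\<lambda>x. W (proj (fst x)) (proj (snd x))) \<in> borel_measurable (MD \<Otimes>\<^sub>M MD)"
    using measurable_compose[OF measurable_Pair[OF measurable_compose[OF measurable_fst proj_measurable]
        measurable_compose[OF measurable_snd proj_measurable]] GM.W_measurable]
    by (simp only: prod.case)
  have "case_prod \<Gamma> = (\<lambda>x. if fst x \<in> S \<union> N \<and> snd x \<in> S \<union> N \<or> fst x \<in> S' \<union> N \<and> snd x \<in> S' \<union> N
      then W (proj (fst x)) (proj (snd x)) else 0)"
    by (auto simp: doubled_graphon_eq)
  also have "\<dots> \<in> borel_measurable (MD \<Otimes>\<^sub>M MD)" by measurable
  finally have meas: "case_prod \<Gamma> \<in> borel_measurable (MD \<Otimes>\<^sub>M MD)" .
  have "0 \<le> \<Gamma> u v \<and> \<Gamma> u v \<le> 1 \<and> \<Gamma> u v = \<Gamma> v u" if "u \<in> space MD" "v \<in> space MD" for u v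
    using measurable_space[OF proj_measurable that(1)] measurable_space[OF proj_measurable that(2)]
      GM.W_nonneg GM.W_le_1 GM.W_sym[of "proj u" "proj v"]
    by (auto simp: doubled_graphon_eq)
  then show "graphon MD \<Gamma>" using meas by (simp add: graphon_def)
qed

text \<open>The edges at a vertex of \<open>S\<close> and at its copy, split along the partition
  used by \<open>integral_MD\<close>: the vertex sees \<open>S\<close> and \<open>N\<close>, the
  copy sees \<open>N\<close> and \<open>S'\<close>.\<close>

lemma indicator_Gamma:
  assumes "v \<in> S"
  shows "indicator (S \<union> N) u * \<Gamma> u v = indicator (S \<union> N) u * W u v"
    and "indicator S u * \<Gamma> (lift u) v = 0"
    and "indicator (S \<union> N) u * \<Gamma> u (lift v) = indicator N u * W u v"
    and "indicator S u * \<Gamma> (lift u) (lift v) = indicator S u * W u v"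
  using assms proj_eq(1)[of u] proj_eq(1)[of v] proj_eq(2)[of u] proj_eq(2)[of v] lift_in[of u] lift_in[of v]
    not_S'(1)[of u] not_S'(2)[of u] not_S'(1)[of v] not_S'(2)[of v] N_subset not_S'(1)[of "lift u"] not_S'(1)[of "lift v"]
    not_S'(2)[of "lift u"] not_S'(2)[of "lift v"]
  by (auto simp: doubled_graphon_eq indicator_def)

lemma indicator_T: "indicator (S \<union> N) u = (indicator S u + indicator N u :: real)"
  using N_subset by (auto simp: indicator_def)

lemma doubled_degree:
  assumes "v \<in> S"
  shows "GD.deg v = (\<integral>u. indicator (S \<union> N) u * W u v \<partial>M)"
    and "GD.deg (lift v) = (\<integral>u. indicator (S \<union> N) u * W u v \<partial>M)"
proof -
  have v: "v \<in> space MD" "lift v \<in> space MD" using assms lift_in by (auto simp: space_MD)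
  show "GD.deg v = (\<integral>u. indicator (S \<union> N) u * W u v \<partial>M)"
    using integral_MD(3)[OF GD.W_section_integrable[OF v(1)]]
    by (simp add: graphon_degree_def indicator_Gamma[OF assms])
  have int: "integrable M (\<lambda>u. indicator A u * W u v)" if "A \<in> sets M" for A
    using integrable_real_mult_indicator[OF that GM.W_section_integrable[of v]] assms S_subset
    by (simp add: mult.commute subset_iff)
  have "(\<integral>u. indicator N u * W u v \<partial>M) + (\<integral>u. indicator S u * W u v \<partial>M) =
      (\<integral>u. indicator N u * W u v + indicator S u * W u v \<partial>M)"
    by (rule Bochner_Integration.integral_add[symmetric, OF int[OF N_sets] int[OF S_sets]])
  then show "GD.deg (lift v) = (\<integral>u. indicator (S \<union> N) u * W u v \<partial>M)"
    using integral_MD(3)[OF GD.W_section_integrable[OF v(2)]]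
    unfolding graphon_degree_def indicator_Gamma[OF assms] unfolding indicator_T
    by (simp add: distrib_right add.commute)
qed

text \<open>For \<open>u\<close> outside \<open>S \<union> N\<close> the integral of
  \<open>W\<close> over \<open>S\<close> is not positive, by definition of the neighborhood, so
  almost every \<open>v\<close> in \<open>S\<close> has no edge to \<open>u\<close>. Fubini
  exchanges the two quantifiers.\<close>

lemma AE_no_edge_outside: "AE v in M. AE u in M. v \<in> S \<longrightarrow> u \<notin> S \<union> N \<longrightarrow> W u v = 0"
proof -
  have "AE u in M. AE v in M. v \<in> S \<longrightarrow> u \<notin> S \<union> N \<longrightarrow> W u v = 0"
  proof (rule AE_I2)
    fix u assume u: "u \<in> space M"
    show "AE v in M. v \<in> S \<longrightarrow> u \<notin> S \<union> N \<longrightarrow> W u v = 0"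
    proof (cases "u \<in> S \<union> N")
      case False
      have int: "integrable M (\<lambda>v. indicator S v * W v u)"
        using integrable_real_mult_indicator[OF S_sets GM.W_section_integrable[OF u]]
        by (simp add: mult.commute)
      have nn: "AE v in M. 0 \<le> indicator S v * W v u"
        using GM.W_nonneg u by (auto intro!: AE_I2)
      have "\<not> (\<integral>v. indicator S v * W v u \<partial>M) > 0" using False u by (auto simp: N_eq)
      then have "(\<integral>v. indicator S v * W v u \<partial>M) = 0" using integral_nonneg_AE[OF nn] by linarith
      then have "AE v in M. indicator S v * W v u = 0"
        unfolding integral_nonneg_eq_0_iff_AE[OF int nn] .
      then show ?thesis using AE_space
        by eventually_elim (use u GM.W_sym in \<open>auto simp: indicator_def\<close>)
    qed simp
  qed
  then show ?thesis
    by (subst GM.MM.AE_commute[symmetric]) measurable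
qed

text \<open>Both degrees in \<open>\<Gamma>\<close> integrate \<open>W\<close> over
  \<open>S \<union> N\<close>. For almost every \<open>v\<close> in \<open>S\<close> this misses
  nothing, by \<open>AE_no_edge_outside\<close>.\<close>

lemma AE_doubled_degree:
  "AE v in M. v \<in> S \<longrightarrow> GD.deg v = GM.deg v \<and> GD.deg (lift v) = GM.deg v"
  using AE_no_edge_outside AE_space
proof eventually_elim
  case (elim v)
  show ?case
  proof
    assume v: "v \<in> S"
    have "(\<integral>u. indicator (S \<union> N) u * W u v \<partial>M) = GM.deg v"
      unfolding graphon_degree_def
    proof (rule integral_cong_AE)
      note [measurable] = GM.W_section_measurable(1)[OF elim(2)]
      show "(\<lambda>u. indicator (S \<union> N) u * W u v) \<in> borel_measurable M" by measurable
      show "(\<lambda>u. W u v) \<in> borel_measurable M" by measurable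
      show "AE u in M. indicator (S \<union> N) u * W u v = W u v"
        using elim(1) by eventually_elim (use v in \<open>auto simp: indicator_def\<close>)
    qed
    then show "GD.deg v = GM.deg v \<and> GD.deg (lift v) = GM.deg v"
      using doubled_degree[OF v] by simp
  qed
qed

section \<open>Odd parts and odd extensions\<close>

definition odd_part :: "(real \<Rightarrow> real) \<Rightarrow> real \<Rightarrow> real" where
  "odd_part f v = indicator S v * (f v - f (lift v))"

definition odd_extension :: "(real \<Rightarrow> real) \<Rightarrow> real \<Rightarrow> real" where
  "odd_extension g x = (indicator S x - indicator S' x) * g (proj x)"

lemma odd_part_in_L2:
  assumes f: "in_L2 MD f"
  shows "in_L2 M (odd_part f)"
proof -
  have int: "integrable MD f" "integrable MD (\<lambda>x. (f x)\<^sup>2)"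
    using in_L2_mult_integrable[OF f in_L2_const[OF D.finite_measure_axioms, of 1]] f
    by (auto simp: in_L2_def)
  have sq: "(indicator A x * a)\<^sup>2 = indicator A x * a\<^sup>2" for A and x a :: real
    by (auto simp: indicator_def)
  have "in_L2 M (\<lambda>x. indicator (S \<union> N) x * f x)"
    using borel_measurable_integrable[OF integral_MD(1)[OF int(1)]] integral_MD(1)[OF int(2)]
    unfolding in_L2_def sq ..
  from in_L2_indicator_mult[OF this S_sets]
  have "in_L2 M (\<lambda>x. indicator S x * f x)"
    by (rule subst[where P = "in_L2 M", rotated]) (auto simp: indicator_def)
  moreover have "in_L2 M (\<lambda>x. indicator S x * f (lift x))"
    using borel_measurable_integrable[OF integral_MD(2)[OF int(1)]] integral_MD(2)[OF int(2)]
    unfolding in_L2_def sq ..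
  ultimately have "in_L2 M (\<lambda>x. indicator S x * f x - indicator S x * f (lift x))"
    by (rule in_L2_diff)
  then show ?thesis by (simp add: odd_part_def[abs_def] right_diff_distrib)
qed

lemma odd_extension_T: "indicator (S \<union> N) x * odd_extension g x = indicator S x * g x"
  and odd_extension_lift: "indicator S x * odd_extension g (lift x) = - indicator S x * g x"
  using not_S'(1)[of x] not_S'(2)[of x] not_S'(1)[of "lift x"] lift_in[of x] proj_eq(1)[of x] proj_eq(2)[of x]
  by (auto simp: odd_extension_def indicator_def)

text \<open>\<open>S\<close> and its copy contribute equally, hence the factor 2. Values of
  \<open>g\<close> outside \<open>S\<close> are discarded by the extension.\<close>

lemma odd_extension_square:
  assumes g: "in_L2 M g"
  shows "in_L2 MD (odd_extension g)"
    and "(L2_norm MD (odd_extension g))\<^sup>2 = 2 * (\<integral>x. indicator S x * (g x)\<^sup>2 \<partial>M)"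
proof -
  have [measurable]: "g \<in> borel_measurable M" using g by (simp add: in_L2_def)
  have m [measurable]: "odd_extension g \<in> borel_measurable MD"
    unfolding odd_extension_def[abs_def] by measurable
  have 1: "indicator (S \<union> N) x * (odd_extension g x)\<^sup>2 = indicator S x * (g x)\<^sup>2"
    "indicator S x * (odd_extension g (lift x))\<^sup>2 = indicator S x * (g x)\<^sup>2" for x
    using odd_extension_T[of x g] odd_extension_lift[of x g]
    by (auto simp: indicator_def split: if_splits)
  have int: "integrable M (\<lambda>x. indicator S x * (g x)\<^sup>2)"
    using g integrable_real_mult_indicator[OF S_sets, of "\<lambda>x. (g x)\<^sup>2"]
    by (simp add: in_L2_def mult.commute)
  have "integrable MD (\<lambda>x. (odd_extension g x)\<^sup>2)"
    by (rule integrable_MDI) (simp_all add: 1 int)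
  then show "in_L2 MD (odd_extension g)"
    and "(L2_norm MD (odd_extension g))\<^sup>2 = 2 * (\<integral>x. indicator S x * (g x)\<^sup>2 \<partial>M)"
    using m integral_MD(3)[of "\<lambda>x. (odd_extension g x)\<^sup>2"]
    by (simp_all add: in_L2_def L2_norm_def 1)
qed

text \<open>Leaving the usual factor 1/2 out of \<open>odd_part\<close> makes it the exact adjoint
  of \<open>odd_extension\<close>.\<close>

lemma inner_odd_extension:
  assumes g: "in_L2 M g" and f: "in_L2 MD f"
  shows "L2_inner MD (odd_extension g) f = (\<integral>x. g x * odd_part f x \<partial>M)"
proof -
  have 1: "indicator (S \<union> N) x * (odd_extension g x * f x) = indicator S x * g x * f x"
    "indicator S x * (odd_extension g (lift x) * f (lift x)) = - indicator S x * g x * f (lift x)" for x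
    using odd_extension_T[of x g] odd_extension_lift[of x g]
    by (simp_all only: mult.assoc[symmetric])
  note int = integral_MD[OF in_L2_mult_integrable[OF odd_extension_square(1)[OF g] f], unfolded 1]
  have "L2_inner MD (odd_extension g) f =
      (\<integral>x. indicator S x * g x * f x + - indicator S x * g x * f (lift x) \<partial>M)"
    unfolding L2_inner_def int(3) by (rule Bochner_Integration.integral_add[symmetric, OF int(1,2)])
  then show ?thesis by (simp add: odd_part_def algebra_simps)
qed

text \<open>Subtract the eigenvalue equation at \<open>lift v\<close> from the one at
  \<open>v\<close>. Both vertices have the degree of \<open>v\<close> in \<open>W\<close>, so the
  contributions of \<open>N\<close> cancel, and those of \<open>S\<close> and its copy combine into
  \<open>adj\<close> of the odd part.\<close>

lemma laplacian_odd_part: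
  assumes f: "in_L2 MD f" and eig: "AE x in MD. normalized_laplacian MD \<Gamma> f x = \<mu> * f x"
  shows "AE v in M. v \<in> S \<longrightarrow> normalized_laplacian M W (odd_part f) v = \<mu> * odd_part f v"
proof -
  let ?G = "normalized_graphon MD \<Gamma>"
  note eig' = AE_MD[OF eig] and int' = AE_MD[OF GD.AE_adj_integrable[OF f]]
  have odd_meas: "odd_part f \<in> borel_measurable M"
    using odd_part_in_L2[OF f] by (simp add: in_L2_def)
  show ?thesis
    using eig' int' AE_doubled_degree AE_space
  proof eventually_elim
    case (elim v)
    show ?case
    proof
      assume v: "v \<in> S"
      have deg: "GD.deg v = GM.deg v" "GD.deg (lift v) = GM.deg v" using elim(5) v by auto
      \<comment> \<open>Integrability of both sections is what allows the two integrals to be split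
        and subtracted.\<close>
      have i1: "integrable MD (\<lambda>u. ?G u v * f u)" and i2: "integrable MD (\<lambda>u. ?G u (lift v) * f u)"
        using elim(3,4) v by auto
      have e1: "indicator (S \<union> N) u * (?G u v * f u) =
          indicator (S \<union> N) u * W u v * (f u / (sqrt (GD.deg u) * sqrt (GM.deg v)))"
        "indicator S u * (?G (lift u) v * f (lift u)) = 0"
        "indicator (S \<union> N) u * (?G u (lift v) * f u) =
          indicator N u * W u v * (f u / (sqrt (GD.deg u) * sqrt (GM.deg v)))"
        "indicator S u * (?G (lift u) (lift v) * f (lift u)) =
          indicator S u * W u v * (f (lift u) / (sqrt (GD.deg (lift u)) * sqrt (GM.deg v)))" for u
        unfolding GD.normalized_graphon_eq deg
        by (simp_all only: times_divide_eq_left times_divide_eq_right mult.assoc[symmetric]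
            indicator_Gamma[OF v] mult_zero_left div_0)
      note j1 = integral_MD[OF i1, unfolded e1] and j2 = integral_MD[OF i2, unfolded e1]
      \<comment> \<open>\<open>F\<close> is the difference of the two integrals over the doubled
        domain, collected into one integrand on the unit interval.\<close>
      define F where "F u = indicator (S \<union> N) u * W u v * (f u / (sqrt (GD.deg u) * sqrt (GM.deg v)))
        - (indicator N u * W u v * (f u / (sqrt (GD.deg u) * sqrt (GM.deg v)))
        + indicator S u * W u v * (f (lift u) / (sqrt (GD.deg (lift u)) * sqrt (GM.deg v))))" for u
      have F: "integrable M F" "(\<integral>u. ?G u v * f u \<partial>MD) - (\<integral>u. ?G u (lift v) * f u \<partial>MD) = (\<integral>u. F u \<partial>M)"
        unfolding F_def[abs_def] j1(3) j2(3)
        using j1(1) j2(1,2) by simp_all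
      have "(\<integral>u. F u \<partial>M) = GM.adj (odd_part f) v"
      proof (rule integral_cong_AE)
        show "F \<in> borel_measurable M" using F(1) by (rule borel_measurable_integrable)
        note [measurable] = odd_meas GM.W_section_measurable(1)[OF elim(6)]
        show "(\<lambda>u. normalized_graphon M W u v * odd_part f u) \<in> borel_measurable M"
          unfolding GM.normalized_graphon_eq by measurable
        \<comment> \<open>Over \<open>N\<close> the terms cancel pointwise. Over \<open>S\<close>
          the degrees of \<open>u\<close> and of its copy are almost everywhere the degree of
          \<open>u\<close> in \<open>W\<close>.\<close>
        show "AE u in M. F u = normalized_graphon M W u v * odd_part f u"
          using AE_doubled_degree
        proof eventually_elim
          case (elim u)
          then show ?case
            unfolding GM.normalized_graphon_eq F_def odd_part_def indicator_T
            by (auto simp: indicator_def diff_divide_distrib right_diff_distrib)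
        qed
      qed
      then show "normalized_laplacian M W (odd_part f) v = \<mu> * odd_part f v"
        using F(2) elim(1,2) v by (simp add: normalized_laplacian_def odd_part_def algebra_simps)
    qed
  qed
qed

end

section \<open>The norm estimate\<close>

theorem theorem2:
  fixes W :: "real \<Rightarrow> real \<Rightarrow> real" and S S' :: "real set" and \<theta> :: "real \<Rightarrow> real"
    and lambda1 :: real and X :: "real \<Rightarrow> real"
  defines "M \<equiv> lebesgue_on {0..1}"
    and "MD \<equiv> doubled_measure W S S' \<theta>"
    and "\<Gamma> \<equiv> doubled_graphon W S S' \<theta>"
  assumes "graphon M W"
    and "S \<in> sets lebesgue" and "S \<subset> {0..1}"
    and "emeasure lebesgue (nbhd W S) > 0"
    and "S' \<inter> {0..1} = {}" and "bij_betw \<theta> S' S"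
    and "no_component_inside M W S"
    and "has_eigenbasis MD (normalized_laplacian MD \<Gamma>)"
    and "smallest_nonzero_eigenvalue MD (normalized_laplacian MD \<Gamma>) lambda1"
    and "in_L2 M X" and "AE x in M. x \<notin> S \<longrightarrow> X x = 0"
  shows "L2_norm M X \<le> 1 / lambda1 * L2_norm M (normalized_laplacian M W X)"
proof -
  interpret D: doubling W S S' \<theta>
    by unfold_locales (use assms in auto)
  note defs = M_def MD_def \<Gamma>_def
  let ?L = "normalized_laplacian M W X"
  have X: "in_L2 M X" by fact
  have LX: "in_L2 M ?L" using D.GM.laplacian_in_L2 X by (simp add: defs)
  obtain e where e: "orthonormal_basis_L2 MD e"
    and eig: "\<And>i. \<exists>\<mu>. eigenfunction MD (normalized_laplacian MD \<Gamma>) \<mu> (e i)"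
    using \<open>has_eigenbasis _ _\<close> by (auto simp: has_eigenbasis_def)
  have ev: "eigenvalue MD (normalized_laplacian MD \<Gamma>) lambda1" and "lambda1 \<noteq> 0"
    and least: "\<And>\<nu>. eigenvalue MD (normalized_laplacian MD \<Gamma>) \<nu> \<Longrightarrow> \<nu> \<noteq> 0 \<Longrightarrow> lambda1 \<le> \<nu>"
    using \<open>smallest_nonzero_eigenvalue _ _ _\<close> by (auto simp: smallest_nonzero_eigenvalue_def)
  \<comment> \<open>The definition of the smallest nonzero eigenvalue only excludes zero; its sign
    comes from nonnegativity of all eigenvalues.\<close>
  have pos: "lambda1 > 0"
    using D.GD.eigenvalue_nonneg ev \<open>lambda1 \<noteq> 0\<close> by (force simp: defs)
  have "lambda1 * \<bar>L2_inner MD (D.odd_extension X) (e i)\<bar> \<le> \<bar>L2_inner MD (D.odd_extension ?L) (e i)\<bar>" for i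
  proof -
    obtain \<mu> where \<mu>: "eigenfunction MD (normalized_laplacian MD \<Gamma>) \<mu> (e i)" using eig by blast
    define h where "h = D.odd_part (e i)"
    have ei: "in_L2 MD (e i)" and eiL: "AE x in MD. normalized_laplacian MD \<Gamma> (e i) x = \<mu> * e i x"
      using \<mu> by (auto simp: eigenfunction_def)
    have h: "in_L2 M h" using D.odd_part_in_L2 ei by (simp add: h_def defs)
    have Lh: "AE v in M. v \<in> S \<longrightarrow> normalized_laplacian M W h v = \<mu> * h v"
      using D.laplacian_odd_part[OF ei[unfolded defs] eiL[unfolded defs]] unfolding h_def defs .
    have "(\<integral>v. ?L v * h v \<partial>M) = (\<integral>v. X v * normalized_laplacian M W h v \<partial>M)"
      using D.GM.laplacian_self_adjoint X h by (simp add: defs)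
    \<comment> \<open>The equation for \<open>h\<close> is known on \<open>S\<close> only; off
      \<open>S\<close> the factor \<open>X\<close> vanishes almost everywhere.\<close>
    also have "\<dots> = (\<integral>v. \<mu> * (X v * h v) \<partial>M)"
    proof (rule integral_cong_AE)
      show "(\<lambda>v. X v * normalized_laplacian M W h v) \<in> borel_measurable M"
        "(\<lambda>v. \<mu> * (X v * h v)) \<in> borel_measurable M"
        using X h D.GM.laplacian_in_L2[of h] by (auto simp: in_L2_def defs)
      show "AE v in M. X v * normalized_laplacian M W h v = \<mu> * (X v * h v)"
        using Lh \<open>AE x in M. x \<notin> S \<longrightarrow> X x = 0\<close> by eventually_elim auto
    qed
    \<comment> \<open>Adjointness of odd extension and odd part turns the relation on the unit
      interval into one between coefficients on the doubled domain.\<close>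
    finally have *: "L2_inner MD (D.odd_extension ?L) (e i) = \<mu> * L2_inner MD (D.odd_extension X) (e i)"
      using D.inner_odd_extension X LX ei by (simp add: h_def defs)
    show ?thesis
    proof (cases "\<mu> = 0")
      case True
      \<comment> \<open>The relation between the coefficients gives no bound for
        \<open>\<mu> = 0\<close>. Instead \<open>h\<close> is supported on \<open>S\<close> and
        solves the kernel equation there, so it vanishes and the coefficient of \<open>X\<close> is
        zero.\<close>
      have "AE v in M. h v = 0"
        unfolding M_def
      proof (rule D.GM.kernel_supported_trivial)
        show "no_component_inside (lebesgue_on {0..1}) W S" "in_L2 (lebesgue_on {0..1}) h"
          using \<open>no_component_inside M W S\<close> h by (simp_all add: M_def)
        show "h x = 0" if "x \<notin> S" for x using that by (simp add: h_def D.odd_part_def)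
        show "AE v in lebesgue_on {0..1}. v \<in> S \<longrightarrow> D.GM.adj h v = h v"
          using Lh unfolding True normalized_laplacian_def M_def by eventually_elim simp
      qed
      then have "AE v in M. X v * h v = 0" by eventually_elim simp
      then have "(\<integral>v. X v * h v \<partial>M) = 0" by (rule integral_eq_zero_AE)
      then have "L2_inner MD (D.odd_extension X) (e i) = 0"
        using D.inner_odd_extension X ei by (simp add: h_def defs)
      then show ?thesis by simp
    next
      case False
      then have "lambda1 \<le> \<mu>" using least \<mu> by (auto simp: eigenvalue_def)
      then have "lambda1 \<le> \<bar>\<mu>\<bar>" by simp
      then show ?thesis unfolding * abs_mult by (rule mult_right_mono) simp
    qed
  qed
  then have "lambda1 * L2_norm MD (D.odd_extension X) \<le> L2_norm MD (D.odd_extension ?L)"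
    using pos D.odd_extension_square(1) X LX
    by (intro L2_norm_le_of_coefficients_le[OF e]) (auto simp: defs)
  then have "(lambda1 * L2_norm MD (D.odd_extension X))\<^sup>2 \<le> (L2_norm MD (D.odd_extension ?L))\<^sup>2"
    using pos by (intro power_mono) (auto simp: L2_norm_def)
  moreover have "(L2_norm MD (D.odd_extension X))\<^sup>2 = 2 * (L2_norm M X)\<^sup>2"
  proof -
    have "(\<integral>x. indicator S x * (X x)\<^sup>2 \<partial>M) = (\<integral>x. (X x)\<^sup>2 \<partial>M)"
    proof (rule integral_cong_AE)
      show "AE x in M. indicator S x * (X x)\<^sup>2 = (X x)\<^sup>2"
        using \<open>AE x in M. x \<notin> S \<longrightarrow> X x = 0\<close> by eventually_elim (auto simp: indicator_def)
    qed (use X D.S_sets in \<open>auto simp: in_L2_def defs\<close>)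
    then show ?thesis using D.odd_extension_square(2) X by (simp add: defs L2_norm_def)
  qed
  \<comment> \<open>Here only an inequality holds, because the Laplacian of \<open>X\<close> may be
    nonzero outside \<open>S\<close>. The factor 2 cancels against the one for
    \<open>X\<close>.\<close>
  moreover have "(L2_norm MD (D.odd_extension ?L))\<^sup>2 \<le> 2 * (L2_norm M ?L)\<^sup>2"
  proof -
    have i: "integrable M (\<lambda>x. (?L x)\<^sup>2)" using LX by (simp add: in_L2_def)
    have "(\<integral>x. indicator S x * (?L x)\<^sup>2 \<partial>M) \<le> (\<integral>x. (?L x)\<^sup>2 \<partial>M)"
    proof (rule integral_mono)
      show "integrable M (\<lambda>x. indicator S x * (?L x)\<^sup>2)"
        using integrable_real_mult_indicator[OF _ i, of S] D.S_sets by (simp add: defs mult.commute)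
    qed (auto simp: i indicator_def)
    then show ?thesis using D.odd_extension_square(2) LX by (simp add: defs L2_norm_def)
  qed
  ultimately have "(lambda1 * L2_norm M X)\<^sup>2 \<le> (L2_norm M ?L)\<^sup>2"
    by (simp add: power_mult_distrib)
  then have "lambda1 * L2_norm M X \<le> L2_norm M ?L"
    by (rule power2_le_imp_le) (simp add: L2_norm_def)
  then show ?thesis using pos by (simp add: field_simps)
qed

end
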